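(* In the message-passing model with $s$ players and no edge duplication, the randomized communication cost of computing a multiplicative $3$-spanner of an $n$-vertex input graph is $\Omega(\sqrt{s}\, n^{3/2})$ bits.
   Context: Message-passing model: there are $s$ players $P^1,\dots,P^s$ and a coordinator. All parties know the vertex set $V$, $|V|=n$; player $P^i$ holds an edge set $E_i$ on $V$, and the input graph is $G=(V,\bigcup_i E_i)$ (unweighted, undirected). Communication is only between the coordinator and individual players; the coordinator must output the spanner. Communication cost is the total number of bits exchanged; randomized protocols must succeed with probability at least $2/3$ on every input. "No edge duplication" means the $E_i$ are pairwise disjoint. A multiplicative $\alpha$-spanner of $G$ is a subgraph $H$ with $d_H(u,v)\le \alpha\, d_G(u,v)$ for all $u,v$. Standing assumption: $s\ll n$. *)

theory Defs
  imports "HOL-Probability.Probability"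
begin

section \<open>Graphs and spanners\<close>

text \<open>
  Graphs are simple and undirected, on the vertex set \<open>{..<n}\<close>; a graph is given by its set of
  edges, each edge being a two-element set of vertices.
\<close>

definition all_edges :: "nat \<Rightarrow> nat set set" where
  "all_edges n = {{u, v} | u v. u < n \<and> v < n \<and> u \<noteq> v}"

definition adj_rel :: "nat set set \<Rightarrow> (nat \<times> nat) set" where
  "adj_rel E = {(u, v). {u, v} \<in> E}"

text \<open>Least number of edges of a walk from \<open>u\<close> to \<open>v\<close>; it is \<open>\<infinity>\<close> if there is none.\<close>

definition graph_dist :: "nat set set \<Rightarrow> nat \<Rightarrow> nat \<Rightarrow> enat" where
  "graph_dist E u v = (INF k \<in> {k. (u, v) \<in> adj_rel E ^^ k}. enat k)"

definition is_spanner :: "real \<Rightarrow> nat \<Rightarrow> nat set set \<Rightarrow> nat set set \<Rightarrow> bool" where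
  "is_spanner \<alpha> n G H \<longleftrightarrow>
     H \<subseteq> G \<and>
     (\<forall>u<n. \<forall>v<n. ereal_of_enat (graph_dist H u v) \<le> ereal \<alpha> * ereal_of_enat (graph_dist G u v))"


section \<open>The message-passing model\<close>

text \<open>
  The players are numbered \<open>0, \<dots>, s - 1\<close>, and player \<open>i\<close> holds the edge set \<open>E i\<close>.  The values
  \<open>E i\<close> for \<open>i \<ge> s\<close> are irrelevant.
\<close>

definition no_dup_input :: "nat \<Rightarrow> nat \<Rightarrow> (nat \<Rightarrow> nat set set) \<Rightarrow> bool" where
  "no_dup_input s n E \<longleftrightarrow> (\<forall>i<s. E i \<subseteq> all_edges n) \<and> disjoint_family_on E {..<s}"

definition input_graph :: "nat \<Rightarrow> (nat \<Rightarrow> nat set set) \<Rightarrow> nat set set" where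
  "input_graph s E = (\<Union>i<s. E i)"

text \<open>
  A message is a single bit, sent on the channel between the coordinator and one player.  The
  coordinator sees the whole history; player \<open>i\<close> sees only what passed on its own channel.
\<close>

datatype message = To_Player bool | From_Player bool

type_synonym history = "(nat \<times> message) list"

definition channel :: "nat \<Rightarrow> history \<Rightarrow> message list" where
  "channel i h = map snd (filter (\<lambda>(j, m). j = i) h)"

text \<open>
  From the history, the coordinator decides either to send a bit to a player, or to
  wait for the next bit of a player, or to stop and output an edge set.  The bit sent by a player
  is a function of its own edge set and of the history of its own channel.  Coins do not appear
  here, because a randomized protocol is a distribution over deterministic ones.
\<close>

datatype action = Send nat bool | Receive nat | Output "nat set set"

record protocol =
  coordinator :: "history \<Rightarrow> action"
  player :: "nat \<Rightarrow> nat set set \<Rightarrow> message list \<Rightarrow> bool"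

text \<open>
  The histories that occur when protocol \<open>P\<close> is run on input \<open>E\<close>.  Every step costs one bit, so
  the number of bits exchanged is the length of the history.  Addressing a player that does not
  exist blocks the run, which then has no output.
\<close>

inductive run :: "nat \<Rightarrow> protocol \<Rightarrow> (nat \<Rightarrow> nat set set) \<Rightarrow> history \<Rightarrow> bool"
  for s P E where
  start: "run s P E []"
| send: "run s P E h \<Longrightarrow> coordinator P h = Send i b \<Longrightarrow> i < s \<Longrightarrow>
    run s P E (h @ [(i, To_Player b)])"
| receive: "run s P E h \<Longrightarrow> coordinator P h = Receive i \<Longrightarrow> i < s \<Longrightarrow>
    run s P E (h @ [(i, From_Player (player P i (E i) (channel i h)))])"

definition outputs :: "nat \<Rightarrow> protocol \<Rightarrow> (nat \<Rightarrow> nat set set) \<Rightarrow> nat set set \<Rightarrow> bool" where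
  "outputs s P E H \<longleftrightarrow> (\<exists>h. run s P E h \<and> coordinator P h = Output H)"


section \<open>Randomized communication cost\<close>

text \<open>
  A randomized protocol is a probability distribution over deterministic protocols (public coins);
  this includes protocols in which the parties flip private coins.
\<close>

definition computes_spanner :: "real \<Rightarrow> nat \<Rightarrow> nat \<Rightarrow> protocol pmf \<Rightarrow> bool" where
  "computes_spanner \<alpha> s n \<pi> \<longleftrightarrow>
     (\<forall>E. no_dup_input s n E \<longrightarrow>
        measure_pmf.prob \<pi> {P. \<exists>H. outputs s P E H \<and> is_spanner \<alpha> n (input_graph s E) H} \<ge> 2 / 3)"

text \<open>Number of bits exchanged in the worst case over the inputs and the coins.\<close>

definition protocol_cost :: "nat \<Rightarrow> nat \<Rightarrow> protocol pmf \<Rightarrow> enat" where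
  "protocol_cost s n \<pi> =
     Sup {enat (length h) | h P E. P \<in> set_pmf \<pi> \<and> no_dup_input s n E \<and> run s P E h}"

definition spanner_comm_cost :: "real \<Rightarrow> nat \<Rightarrow> nat \<Rightarrow> enat" where
  "spanner_comm_cost \<alpha> s n = (INF \<pi> \<in> {\<pi>. computes_spanner \<alpha> s n \<pi>}. protocol_cost s n \<pi>)"

end

theory Submission
  imports Defs "HOL-Library.Sublist" "HOL-Number_Theory.Cong" "HOL-Real_Asymp.Real_Asymp"
begin

text \<open>
  Let \<open>R\<close> be the point-line incidence graph of an affine plane of prime order \<open>p\<close>, with \<open>p\<^sup>2\<close> vertices
  on each side, \<open>p\<^sup>3\<close> edges and no 4-cycle, where \<open>p\<close> is of order \<open>sqrt (n / s)\<close>.  Replace every vertex by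
  \<open>s\<close> copies, so that every edge of \<open>R\<close> becomes a blob \<open>K(s, s)\<close>, and give player \<open>i\<close> a random part of
  the \<open>i\<close>-th perfect matching of every blob.  Within each blob, every vertex has a random type, and an
  edge may be present only if both its ends have type \<open>True\<close>.  If an edge with both ends of type
  \<open>False\<close> is planted, then it is isolated in its blob and belongs to every 3-spanner because \<open>R\<close> has no
  4-cycle; without the planting it belongs to none.

  Player \<open>i\<close> does not know the types, and the others do not know the edges of player \<open>i\<close>, so that the
  question whether there is a planted edge is a set disjointness problem on \<open>p\<^sup>3 * s\<close> positions between
  player \<open>i\<close> and everybody else.  Hence in the unplanted distribution, which is the same for all
  players, the expected number of bits on each channel is of order \<open>p\<^sup>3 * s\<close>, and in total
  \<open>p\<^sup>3 * s\<^sup>2\<close>, which is of order \<open>sqrt s * n powr (3 / 2)\<close>.  The bound for disjointness follows the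
  information complexity argument of Bar-Yossef, Jayram, Kumar and Sivakumar.
\<close>

section \<open>Averages over finite product spaces\<close>

text \<open>Expectation for independent uniform coordinates. All of the probability over inputs is
  expressed by such finite averages, so that measures are needed only for the coins of the
  protocol.\<close>

definition avg :: "'j set \<Rightarrow> (('j \<Rightarrow> 'a::finite) \<Rightarrow> real) \<Rightarrow> real" where
  "avg J F = (\<Sum>z\<in>PiE J (\<lambda>_. UNIV). F z) / real CARD('a) ^ card J"

lemma avg_empty [simp]: "avg {} F = F (\<lambda>_. undefined)"
  by (simp add: avg_def)

lemma avg_insert:
  fixes F :: "('j \<Rightarrow> 'a::finite) \<Rightarrow> real"
  assumes "finite J" "k \<notin> J"
  shows "avg (insert k J) F = (\<Sum>a\<in>UNIV. avg J (\<lambda>z. F (z(k := a)))) / real CARD('a)"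
proof -
  have inj: "inj_on (\<lambda>(y, g). g(k := y)) ((UNIV::'a set) \<times> PiE J (\<lambda>_. UNIV))"
    using inj_combinator[OF assms(2), of "\<lambda>_. UNIV"] by simp
  have "(\<Sum>z\<in>PiE (insert k J) (\<lambda>_. UNIV). F z)
      = (\<Sum>a\<in>UNIV. \<Sum>z\<in>PiE J (\<lambda>_. UNIV). F (z(k := a)))"
    unfolding PiE_insert_eq
    by (subst sum.reindex[OF inj]) (auto simp: sum.cartesian_product case_prod_unfold intro!: sum.cong)
  then show ?thesis
    using assms by (simp add: avg_def sum_divide_distrib[symmetric] mult.commute)
qed

lemma avg_cong: "(\<And>z. z \<in> PiE J (\<lambda>_. UNIV) \<Longrightarrow> F z = G z) \<Longrightarrow> avg J F = avg J G"
  by (simp add: avg_def)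

lemma avg_const [simp]:
  assumes "finite J"
  shows "avg J (\<lambda>z :: 'j \<Rightarrow> 'a::finite. c) = c"
  using assms by (simp add: avg_def card_PiE)

lemma avg_add: "avg J (\<lambda>z. F z + G z) = avg J F + avg J G"
  by (simp add: avg_def sum.distrib add_divide_distrib)

lemma avg_diff: "avg J (\<lambda>z. F z - G z) = avg J F - avg J G"
  by (simp add: avg_def sum_subtractf diff_divide_distrib)

lemma avg_cmult: "avg J (\<lambda>z. c * F z) = c * avg J F"
  by (simp add: avg_def sum_distrib_left)

lemma avg_multc: "avg J (\<lambda>z. F z * c) = avg J F * c"
  by (simp add: avg_def sum_distrib_right)

lemma avg_divide: "avg J (\<lambda>z. F z / c) = avg J F / c"
  by (simp add: avg_def sum_divide_distrib mult.commute)

lemma avg_sum: "avg J (\<lambda>z. \<Sum>l\<in>L. F l z) = (\<Sum>l\<in>L. avg J (F l))"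
  unfolding avg_def by (subst sum.swap) (simp add: sum_divide_distrib)

lemma avg_mono: "(\<And>z. z \<in> PiE J (\<lambda>_. UNIV) \<Longrightarrow> F z \<le> G z) \<Longrightarrow> avg J F \<le> avg J G"
  unfolding avg_def by (intro divide_right_mono sum_mono) auto

lemma avg_nonneg: "(\<And>z. 0 \<le> F z) \<Longrightarrow> 0 \<le> avg J F"
  unfolding avg_def by (intro divide_nonneg_nonneg sum_nonneg) auto

lemma avg_swap: "avg J (\<lambda>z. avg K (\<lambda>w. F z w)) = avg K (\<lambda>w. avg J (\<lambda>z. F z w))"
  unfolding avg_def
  by (simp add: sum_divide_distrib[symmetric]) (subst sum.swap, simp add: mult.commute)

text \<open>The coordinate \<open>k\<close> of \<open>z\<close> is overwritten before
  \<open>F\<close> looks at it, so keeping \<open>k\<close> in the index set changes nothing. This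
  is how a single coordinate is conditioned on below.\<close>

lemma avg_resample:
  fixes F :: "('j \<Rightarrow> 'a::finite) \<Rightarrow> real"
  assumes "finite J" "k \<in> J"
  shows "avg J F = (\<Sum>a\<in>UNIV. avg J (\<lambda>z. F (z(k := a)))) / real CARD('a)"
proof -
  have J: "J = insert k (J - {k})" "finite (J - {k})" "k \<notin> J - {k}"
    using assms by auto
  have "avg J (\<lambda>z. F (z(k := a))) = avg (J - {k}) (\<lambda>z. F (z(k := a)))" for a
    by (subst J(1), subst avg_insert[OF J(2,3)]) simp
  then show ?thesis
    by (subst J(1), subst avg_insert[OF J(2,3)]) simp
qed

text \<open>A product distribution is determined by its factors: \<open>eq\<close> says that one
  coordinate has the same law on both sides, tested against all functions \<open>G\<close>, and the
  induction peels off one coordinate at a time. The three averages stay separate so that the inner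
  two can be studied for a fixed outer one.\<close>

lemma avg_transport3:
  fixes f :: "'a::finite \<Rightarrow> 'b::finite \<Rightarrow> 'c::finite \<Rightarrow> 'e" and g :: "'d::finite \<Rightarrow> 'e"
    and F :: "('j \<Rightarrow> 'e) \<Rightarrow> real"
  assumes "finite J"
    and eq: "\<And>G :: 'e \<Rightarrow> real. (\<Sum>t\<in>UNIV. \<Sum>u\<in>UNIV. \<Sum>d\<in>UNIV. G (f d u t)) / 
        (real CARD('a) * real CARD('b) * real CARD('c)) = (\<Sum>z\<in>UNIV. G (g z)) / real CARD('d)"
  shows "avg J (\<lambda>D. avg J (\<lambda>u. avg J (\<lambda>t. F (\<lambda>j\<in>J. f (D j) (u j) (t j)))))
       = avg J (\<lambda>z. F (\<lambda>j\<in>J. g (z j)))"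
  using assms(1)
proof (induction J arbitrary: F)
  case empty
  then show ?case by simp
next
  case (insert k J)
  have upd: "(\<lambda>j\<in>insert k J. f (if j = k then d else D j) (if j = k then v else u j) (if j = k then r else t j))
      = (\<lambda>j\<in>J. f (D j) (u j) (t j))(k := f d v r)" for D u t d v r
    using insert.hyps(2) by (auto simp: restrict_def fun_eq_iff)
  have upd': "(\<lambda>j\<in>insert k J. g (if j = k then r else z j)) = (\<lambda>j\<in>J. g (z j))(k := g r)" for z r
    using insert.hyps(2) by (auto simp: restrict_def fun_eq_iff)
  define G where "G e = avg J (\<lambda>z. F ((\<lambda>j\<in>J. g (z j))(k := e)))" for e
  have "avg (insert k J) (\<lambda>D. avg (insert k J) (\<lambda>u. avg (insert k J)
        (\<lambda>t. F (\<lambda>j\<in>insert k J. f (D j) (u j) (t j)))))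
     = (\<Sum>r\<in>UNIV. \<Sum>v\<in>UNIV. \<Sum>d\<in>UNIV. avg J (\<lambda>D. avg J (\<lambda>u. avg J (\<lambda>t.
          F ((\<lambda>j\<in>J. f (D j) (u j) (t j))(k := f d v r)))))) 
        / (real CARD('a) * real CARD('b) * real CARD('c))"
    using insert.hyps
    by (simp add: avg_insert avg_sum avg_divide upd sum_divide_distrib[symmetric] field_simps)
  also have "\<dots> = (\<Sum>r\<in>UNIV. \<Sum>v\<in>UNIV. \<Sum>d\<in>UNIV. G (f d v r)) 
        / (real CARD('a) * real CARD('b) * real CARD('c))"
    by (subst insert.IH[where F = "\<lambda>w. F (w(k := c))" for c]) (simp add: G_def)
  also have "\<dots> = (\<Sum>z\<in>UNIV. G (g z)) / real CARD('d)"
    by (rule eq)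
  also have "\<dots> = avg (insert k J) (\<lambda>z. F (\<lambda>j\<in>insert k J. g (z j)))"
    using insert.hyps by (simp add: avg_insert upd' G_def)
  finally show ?case .
qed

section \<open>Entropy inequalities on the Boolean cube\<close>

lemma binary_pinsker_aux:
  fixes t :: real
  assumes "0 \<le> t" "t < 1"
  shows "t\<^sup>2 \<le> (1 + t) * ln (1 + t) + (1 - t) * ln (1 - t)"
proof -
  \<comment> \<open>The difference \<open>g\<close> vanishes at 0, as does its derivative, which is
    the function \<open>h\<close> below; the derivative of \<open>h\<close> is nonnegative.\<close>
  define g where "g = (\<lambda>t::real. (1 + t) * ln (1 + t) + (1 - t) * ln (1 - t) - t\<^sup>2)"
  have "g 0 \<le> g t"
  proof (rule DERIV_nonneg_imp_nondecreasing[OF assms(1)])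
    fix x assume x: "0 \<le> x" "x \<le> t"
    then have x1: "x < 1" using assms by simp
    have "(g has_real_derivative (ln (1 + x) - ln (1 - x) - 2 * x)) (at x)"
    proof -
      have "(g has_real_derivative (ln (1 + x) + (1 + x) * (1 / (1 + x)) 
          + (- ln (1 - x) + (1 - x) * (- 1 / (1 - x))) - 2 * x)) (at x)"
        unfolding g_def using x x1 by (auto intro!: derivative_eq_intros)
      then show ?thesis using x x1 by simp
    qed
    moreover have "0 \<le> ln (1 + x) - ln (1 - x) - 2 * x"
    proof -
      define h where "h = (\<lambda>x::real. ln (1 + x) - ln (1 - x) - 2 * x)"
      have "h 0 \<le> h x"
      proof (rule DERIV_nonneg_imp_nondecreasing[OF x(1)])
        fix y assume y: "0 \<le> y" "y \<le> x"
        then have y1: "y < 1" using x1 by simp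
        have "(h has_real_derivative (1 / (1 + y) + 1 / (1 - y) - 2)) (at y)"
          unfolding h_def using y y1 by (auto intro!: derivative_eq_intros)
        moreover have "1 - y \<le> 1 / (1 + y)" "1 + y \<le> 1 / (1 - y)"
          using y y1 by (simp_all add: field_simps)
        ultimately show "\<exists>d. (h has_real_derivative d) (at y) \<and> 0 \<le> d"
          using y y1 by (intro exI[of _ "1 / (1 + y) + 1 / (1 - y) - 2"]) auto
      qed
      then show ?thesis by (simp add: h_def)
    qed
    ultimately show "\<exists>d. (g has_real_derivative d) (at x) \<and> 0 \<le> d" by blast
  qed
  then show ?thesis by (simp add: g_def)
qed

text \<open>This is \<open>level1_inequality\<close> for a single coordinate. With mean
  \<open>m\<close> and \<open>x = m * (1 + t)\<close>, \<open>y = m * (1 - t)\<close> it is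
  \<open>binary_pinsker_aux\<close> multiplied by \<open>m / 2\<close>. The boundary case
  \<open>t = 1\<close>, that is \<open>y = 0\<close>, amounts to \<open>ln 2\<close> being at least
  1/2.\<close>

lemma binary_pinsker:
  fixes x y :: real
  assumes "0 \<le> x" "0 \<le> y"
  shows "((x - y) / 2)\<^sup>2 / (2 * ((x + y) / 2)) - (x * ln x + y * ln y) / 2 
         \<le> - ((x + y) / 2) * ln ((x + y) / 2)"
proof -
  have main: "((x - y) / 2)\<^sup>2 / (2 * ((x + y) / 2)) - (x * ln x + y * ln y) / 2 
         \<le> - ((x + y) / 2) * ln ((x + y) / 2)" if xy: "0 \<le> y" "y \<le> x" for x y :: real
  proof (cases "y = 0")
    case True
    show ?thesis
    proof (cases "x = 0")
      case False
      then have x: "x > 0" using xy by simp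
      have l2: "ln (2::real) \<ge> 1/2" using ln_ge_iff[of 2 "1/2"] exp_half_le2 by simp
      have "((x - 0) / 2)\<^sup>2 / (2 * ((x + 0) / 2)) = x / 4"
        using x by (simp add: power2_eq_square)
      moreover have "x * ln (x / 2) = x * ln x - x * ln 2" using x by (simp add: ln_div algebra_simps)
      moreover have "x * ln 2 \<ge> x * (1/2)" using x l2 by (intro mult_left_mono) auto
      moreover have "- ((x + 0) / 2) * ln ((x + 0) / 2) = - (x * ln (x / 2)) / 2" by simp
      ultimately show ?thesis unfolding True mult_zero_left by argo
    qed (use True in auto)
  next
    case False
    then have y: "y > 0" "x > 0" using xy by auto
    define m where "m = (x + y) / 2"
    define t where "t = (x - y) / (x + y)"
    have m: "m > 0" using y by (simp add: m_def)
    have t: "0 \<le> t" "t < 1" using y xy by (auto simp: t_def)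
    have xe: "x = m * (1 + t)" and ye: "y = m * (1 - t)"
      using y by (auto simp: m_def t_def field_simps)
    have "((x - y) / 2)\<^sup>2 / (2 * m) = m * t\<^sup>2 / 2"
      using m by (simp add: xe ye field_simps power2_eq_square)
    moreover have "x * ln x + y * ln y = m * ((1 + t) * ln (1 + t) + (1 - t) * ln (1 - t)) + 2 * m * ln m"
    proof -
      have "ln x = ln m + ln (1 + t)" "ln y = ln m + ln (1 - t)"
        unfolding xe ye using m t by (simp_all add: ln_mult)
      then show ?thesis by (simp add: xe ye algebra_simps)
    qed
    moreover have "m * t\<^sup>2 \<le> m * ((1 + t) * ln (1 + t) + (1 - t) * ln (1 - t))"
      using m binary_pinsker_aux[OF t] by (intro mult_left_mono) auto
    ultimately show ?thesis
      unfolding m_def[symmetric] by (simp add: algebra_simps)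
  qed
  show ?thesis
  proof (cases "y \<le> x")
    case True
    then show ?thesis using main assms by blast
  next
    case False
    then have "((y - x) / 2)\<^sup>2 / (2 * ((y + x) / 2)) - (y * ln y + x * ln x) / 2 
         \<le> - ((y + x) / 2) * ln ((y + x) / 2)"
      using main assms by simp
    moreover have "((y - x) / 2)\<^sup>2 = ((x - y) / 2)\<^sup>2"
      by (simp add: power2_eq_square field_simps)
    ultimately show ?thesis by (simp add: add.commute)
  qed
qed

text \<open>Midpoint convexity of \<open>x\<^sup>2 / (2 * m)\<close> in the pair of \<open>x\<close>
  and \<open>m\<close>. The last two assumptions make this survive the convention that division by 0
  gives 0.\<close>

lemma titu_inequality:
  fixes x y m k :: real
  assumes "0 \<le> m" "0 \<le> k" "m = 0 \<Longrightarrow> x = 0" "k = 0 \<Longrightarrow> y = 0"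
  shows "((x + y) / 2)\<^sup>2 / (2 * ((m + k) / 2)) \<le> (x\<^sup>2 / (2 * m) + y\<^sup>2 / (2 * k)) / 2"
proof (cases "m = 0 \<or> k = 0")
  case True
  then show ?thesis using assms by (auto simp: field_simps power2_eq_square)
next
  case False
  then have p: "m > 0" "k > 0" using assms by auto
  have "(x\<^sup>2 / (2 * m) + y\<^sup>2 / (2 * k)) / 2 - ((x + y) / 2)\<^sup>2 / (2 * ((m + k) / 2))
     = (x * k - y * m)\<^sup>2 / (4 * m * k * (m + k))"
    using p by (simp add: divide_simps) (simp add: algebra_simps power2_eq_square)
  moreover have "\<dots> \<ge> 0" using p by (intro divide_nonneg_nonneg) auto
  ultimately show ?thesis by linarith
qed

definition sign_of :: "bool \<Rightarrow> real" where "sign_of c = (if c then 1 else -1)"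

lemma sign_of_simps [simp]: "sign_of True = 1" "sign_of False = -1"
  by (simp_all add: sign_of_def)

text \<open>The degree-one Fourier coefficients of \<open>f\<close> are bounded by its entropy
  deficit. Induction splits \<open>f\<close> at a new coordinate \<open>k\<close> into
  \<open>f1\<close> and \<open>f0\<close>: the term of \<open>k\<close> is
  \<open>binary_pinsker\<close> for the two means, the other terms are handled by the convexity in
  \<open>titu_inequality\<close>.\<close>

lemma level1_inequality:
  fixes f :: "('j \<Rightarrow> bool) \<Rightarrow> real"
  assumes "finite J" and "\<And>u. 0 \<le> f u"
  shows "(\<Sum>j\<in>J. (avg J (\<lambda>u. sign_of (u j) * f u))\<^sup>2 / (2 * avg J f)) 
      - avg J (\<lambda>u. f u * ln (f u)) \<le> - avg J f * ln (avg J f)"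
  using assms
proof (induction J arbitrary: f)
  case empty
  then show ?case by simp
next
  case (insert k J)
  define f1 where "f1 u = f (u(k := True))" for u
  define f0 where "f0 u = f (u(k := False))" for u
  define m1 where "m1 = avg J f1"
  define m0 where "m0 = avg J f0"
  define e1 where "e1 j = avg J (\<lambda>u. sign_of (u j) * f1 u)" for j
  define e0 where "e0 j = avg J (\<lambda>u. sign_of (u j) * f0 u)" for j
  have nn: "0 \<le> m1" "0 \<le> m0" 
    unfolding m1_def m0_def by (auto intro!: avg_nonneg insert.prems simp: f1_def f0_def)
  \<comment> \<open>A nonnegative function of mean 0 has no Fourier coefficients, which is the side
    condition of \<open>titu_inequality\<close>.\<close>
  have z: "avg J (\<lambda>u. sign_of (u j) * g u) = 0" if "avg J g = 0" "\<And>u. 0 \<le> g u" for g :: "('j \<Rightarrow> bool) \<Rightarrow> real" and j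
  proof -
    have "avg J (\<lambda>u. sign_of (u j) * g u) \<le> avg J g" "avg J (\<lambda>u. (-1) * g u) \<le> avg J (\<lambda>u. sign_of (u j) * g u)"
      using that(2) by (auto intro!: avg_mono simp: sign_of_def)
    then show ?thesis using that(1) unfolding avg_cmult by simp
  qed
  have z1: "m1 = 0 \<Longrightarrow> e1 j = 0" and z0: "m0 = 0 \<Longrightarrow> e0 j = 0" for j
    using z[of f1 j] z[of f0 j] insert.prems by (auto simp: m1_def m0_def e1_def e0_def f1_def f0_def)
  have m: "avg (insert k J) f = (m1 + m0) / 2"
    using insert.hyps by (simp add: avg_insert UNIV_bool m1_def m0_def f1_def[abs_def] f0_def[abs_def] add.commute)
  have ek: "avg (insert k J) (\<lambda>u. sign_of (u k) * f u) = (m1 - m0) / 2"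
    using insert.hyps by (simp add: avg_insert UNIV_bool m1_def m0_def f1_def[abs_def] f0_def[abs_def] avg_cmult[where c = "-1", simplified])
  have ej: "avg (insert k J) (\<lambda>u. sign_of (u j) * f u) = (e1 j + e0 j) / 2" if "j \<in> J" for j
  proof -
    have "j \<noteq> k" using that insert.hyps by auto
    then show ?thesis
      using insert.hyps by (simp add: avg_insert UNIV_bool e1_def e0_def f1_def f0_def add.commute)
  qed
  have l: "avg (insert k J) (\<lambda>u. f u * ln (f u)) 
      = (avg J (\<lambda>u. f1 u * ln (f1 u)) + avg J (\<lambda>u. f0 u * ln (f0 u))) / 2"
    using insert.hyps by (simp add: avg_insert UNIV_bool f1_def f0_def add.commute)
  have IH1: "(\<Sum>j\<in>J. (e1 j)\<^sup>2 / (2 * m1)) - avg J (\<lambda>u. f1 u * ln (f1 u)) \<le> - m1 * ln m1"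
    unfolding e1_def m1_def by (rule insert.IH) (simp add: f1_def insert.prems)
  have IH0: "(\<Sum>j\<in>J. (e0 j)\<^sup>2 / (2 * m0)) - avg J (\<lambda>u. f0 u * ln (f0 u)) \<le> - m0 * ln m0"
    unfolding e0_def m0_def by (rule insert.IH) (simp add: f0_def insert.prems)
  have "(\<Sum>j\<in>J. (avg (insert k J) (\<lambda>u. sign_of (u j) * f u))\<^sup>2 / (2 * avg (insert k J) f))
      \<le> (\<Sum>j\<in>J. ((e1 j)\<^sup>2 / (2 * m1) + (e0 j)\<^sup>2 / (2 * m0)) / 2)"
    unfolding m by (intro sum_mono) (simp only: ej titu_inequality[OF nn z1 z0])
  also have "\<dots> = ((\<Sum>j\<in>J. (e1 j)\<^sup>2 / (2 * m1)) + (\<Sum>j\<in>J. (e0 j)\<^sup>2 / (2 * m0))) / 2"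
    by (simp add: sum.distrib sum_divide_distrib add_divide_distrib)
  finally have S: "(\<Sum>j\<in>J. (avg (insert k J) (\<lambda>u. sign_of (u j) * f u))\<^sup>2 / (2 * avg (insert k J) f)) 
    \<le> \<dots>" .
  have P: "((m1 - m0) / 2)\<^sup>2 / (2 * ((m1 + m0) / 2)) - (m1 * ln m1 + m0 * ln m0) / 2 
         \<le> - ((m1 + m0) / 2) * ln ((m1 + m0) / 2)"
    by (rule binary_pinsker[OF nn])
  show ?case
    unfolding sum.insert[OF insert.hyps] ek l
    using S P IH1 IH0 unfolding m by argo
qed

lemma level1_inequality_bounded:
  fixes f :: "('j \<Rightarrow> bool) \<Rightarrow> real"
  assumes "finite J" and "\<And>u. 0 \<le> f u" and "\<And>u. f u \<le> 1"
  shows "(\<Sum>j\<in>J. (avg J (\<lambda>u. sign_of (u j) * f u))\<^sup>2 / (2 * avg J f)) \<le> - avg J f * ln (avg J f)"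
proof -
  have "f u * ln (f u) \<le> 0" for u
    using assms(2,3)[of u] by (cases "f u = 0") (auto simp: mult_nonneg_nonpos)
  then have "avg J (\<lambda>u. f u * ln (f u)) \<le> avg J (\<lambda>u :: 'j \<Rightarrow> bool. 0)"
    by (intro avg_mono) auto
  then show ?thesis 
    using level1_inequality[of J f, OF assms(1,2)] assms(1) by simp
qed

text \<open>Gibbs' inequality, from \<open>ln x \<le> x - 1\<close>. With \<open>W\<close>
  decreasing exponentially in the length of a transcript, it bounds the entropy of the transcript by
  its expected length.\<close>

lemma gibbs:
  fixes P W :: "'l \<Rightarrow> real"
  assumes "finite L" "\<And>l. l \<in> L \<Longrightarrow> 0 \<le> P l" "(\<Sum>l\<in>L. P l) = 1" 
    and "\<And>l. l \<in> L \<Longrightarrow> 0 < W l" "(\<Sum>l\<in>L. W l) \<le> 1"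
  shows "(\<Sum>l\<in>L. - P l * ln (P l)) \<le> (\<Sum>l\<in>L. P l * ln (1 / W l))"
proof -
  have "- P l * ln (P l) - P l * ln (1 / W l) \<le> W l - P l" if l: "l \<in> L" for l
  proof (cases "P l = 0")
    case True
    then show ?thesis using assms(4)[OF l] by simp
  next
    case False
    then have p: "P l > 0" using assms(2)[OF l] by simp
    have "ln (W l / P l) \<le> W l / P l - 1"
      using p assms(4)[OF l] by (intro ln_le_minus_one) auto
    then have "P l * ln (W l / P l) \<le> P l * (W l / P l - 1)"
      using p by (intro mult_left_mono) auto
    then show ?thesis
      using p assms(4)[OF l] by (simp add: ln_div algebra_simps)
  qed
  then have "(\<Sum>l\<in>L. - P l * ln (P l) - P l * ln (1 / W l)) \<le> (\<Sum>l\<in>L. W l - P l)"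
    by (intro sum_mono)
  also have "\<dots> \<le> 0" using assms by (simp add: sum_subtractf)
  finally show ?thesis by (simp add: sum_subtractf)
qed

lemma avg_resample_inside:
  fixes F :: "('j \<Rightarrow> bool) \<Rightarrow> real"
  assumes "finite J" "k \<in> J"
  shows "avg J F = avg J (\<lambda>z. (\<Sum>a\<in>UNIV. F (z(k := a))) / 2)"
  by (subst avg_resample[OF assms]) (simp add: avg_divide avg_sum)

section \<open>A two-party lower bound of disjointness type\<close>

text \<open>Multiply by \<open>x + y\<close>, which is at most
  \<open>(sqrt x + sqrt y)\<^sup>2\<close>. It replaces the quantity from the level-one inequality
  by a Hellinger distance, which has a triangle inequality and the cut-and-paste property.\<close>

lemma hellinger_le:
  fixes x y :: real
  assumes "0 \<le> x" "0 \<le> y"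
  shows "(sqrt x - sqrt y)\<^sup>2 / 4 \<le> ((x - y) / 2)\<^sup>2 / (2 * ((x + y) / 2))"
proof (cases "x + y = 0")
  case True
  then have "x = 0" "y = 0" using assms by auto
  then show ?thesis by simp
next
  case False
  then have p: "x + y > 0" using assms by auto
  define u v where "u = sqrt x" and "v = sqrt y"
  have uv: "x = u\<^sup>2" "y = v\<^sup>2" "0 \<le> u" "0 \<le> v" using assms by (auto simp: u_def v_def)
  have "(u - v)\<^sup>2 * (x + y) \<le> (u - v)\<^sup>2 * (u + v)\<^sup>2"
    using uv by (intro mult_left_mono zero_le_power2) (simp add: power2_eq_square algebra_simps)
  also have "\<dots> = (x - y)\<^sup>2" unfolding uv by (simp add: power2_eq_square algebra_simps)
  finally have "(u - v)\<^sup>2 \<le> (x - y)\<^sup>2 / (x + y)"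
    using p by (simp add: pos_le_divide_eq)
  moreover have "((x - y) / 2)\<^sup>2 / (2 * (S / 2)) = (x - y)\<^sup>2 / S / 4" for S
    by (simp add: power_divide)
  ultimately show ?thesis
    unfolding u_def[symmetric] v_def[symmetric] by (metis divide_right_mono zero_le_numeral)
qed

text \<open>
  \<open>a0\<close>, \<open>a1\<close> are the probabilities that the first party is consistent with a transcript, given its bit,
  and \<open>p\<close>, \<open>r\<close> those for the second party.  The distributions \<open>a1 * p\<close>, \<open>a0 * r\<close> have the same Hellinger
  distance as \<open>a1 * r\<close>, \<open>a0 * p\<close>.
\<close>

lemma cut_paste:
  fixes a0 a1 p r q :: "'l \<Rightarrow> real"
  assumes nn: "\<And>l. 0 \<le> a0 l" "\<And>l. 0 \<le> a1 l" "\<And>l. 0 \<le> p l" "\<And>l. 0 \<le> r l"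
    and n1: "(\<Sum>l\<in>L. a0 l * p l) = 1" "(\<Sum>l\<in>L. a1 l * p l) = 1"
      "(\<Sum>l\<in>L. a0 l * r l) = 1" "(\<Sum>l\<in>L. a1 l * r l) = 1"
    and q: "\<And>l. 0 \<le> q l" "\<And>l. q l \<le> p l"
  shows "(\<Sum>l\<in>L. (a1 l - a0 l) * q l) 
    \<le> 36 * (\<Sum>l\<in>L. r l * (sqrt (a1 l) - sqrt (a0 l))\<^sup>2 + a0 l * (sqrt (r l) - sqrt (p l))\<^sup>2) + 1 / 6"
proof -
  define u w P R where "u l = sqrt (a1 l)" and "w l = sqrt (a0 l)" and "P l = sqrt (p l)" 
    and "R l = sqrt (r l)" for l
  have sq: "a1 l = (u l)\<^sup>2" "a0 l = (w l)\<^sup>2" "p l = (P l)\<^sup>2" "r l = (R l)\<^sup>2" for l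
    using nn by (simp_all add: u_def w_def P_def R_def)
  \<comment> \<open>Squared Hellinger distances, up to a factor: \<open>A\<close> between
    \<open>a1 * r\<close> and \<open>a0 * r\<close>, \<open>B\<close> between \<open>a0 * r\<close>
    and \<open>a0 * p\<close>, \<open>C\<close> between \<open>a1 * p\<close> and
    \<open>a0 * p\<close>, \<open>E\<close> between \<open>a1 * p\<close> and \<open>a0 * r\<close>.
    The aim is to bound \<open>C\<close> by \<open>A\<close> and \<open>B\<close>, with
    \<open>E\<close> as the intermediate quantity that cut-and-paste controls.\<close>
  define A where "A = (\<Sum>l\<in>L. (u l * R l - w l * R l)\<^sup>2)"
  define B where "B = (\<Sum>l\<in>L. (w l * R l - w l * P l)\<^sup>2)"
  define C where "C = (\<Sum>l\<in>L. (u l * P l - w l * P l)\<^sup>2)"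
  define E where "E = (\<Sum>l\<in>L. (u l * P l - w l * R l)\<^sup>2)"
  have nAB: "0 \<le> A" "0 \<le> B" by (auto simp: A_def B_def intro: sum_nonneg)
  have two: "(x + y)\<^sup>2 \<le> 2 * x\<^sup>2 + 2 * y\<^sup>2" for x y :: real
    using zero_le_power2[of "x - y"] by (simp add: power2_eq_square algebra_simps)
  have "E = (\<Sum>l\<in>L. a1 l * p l + a0 l * r l - 2 * (u l * w l * P l * R l))"
    unfolding E_def sq by (intro sum.cong) (auto simp: power2_eq_square algebra_simps)
  also have "\<dots> = (\<Sum>l\<in>L. a1 l * r l + a0 l * p l - 2 * (u l * w l * P l * R l))"
    by (simp add: sum.distrib sum_subtractf n1)
  also have "\<dots> = (\<Sum>l\<in>L. (u l * R l - w l * P l)\<^sup>2)"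
    unfolding sq by (intro sum.cong) (auto simp: power2_eq_square algebra_simps)
  also have "\<dots> \<le> (\<Sum>l\<in>L. 2 * (u l * R l - w l * R l)\<^sup>2 + 2 * (w l * R l - w l * P l)\<^sup>2)"
    by (intro sum_mono order.trans[OF _ two]) simp
  also have "\<dots> = 2 * A + 2 * B"
    by (simp add: A_def B_def sum.distrib sum_distrib_left)
  finally have E: "E \<le> 2 * A + 2 * B" .
  have "C \<le> (\<Sum>l\<in>L. 2 * (u l * P l - w l * R l)\<^sup>2 + 2 * (w l * R l - w l * P l)\<^sup>2)"
    unfolding C_def by (intro sum_mono order.trans[OF _ two]) simp
  also have "\<dots> = 2 * E + 2 * B"
    by (simp add: E_def B_def sum.distrib sum_distrib_left)
  finally have C: "C \<le> 4 * A + 6 * B" using E by simp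
  \<comment> \<open>Weighted arithmetic-geometric mean inequality. The weights make the constant
    left after summation equal to 1/6, safely below the advantage 1/3 that the success probability
    will force; \<open>6 * C\<close> is then at most \<open>36 * (A + B)\<close>.\<close>
  have "(a1 l - a0 l) * q l \<le> 6 * (u l * P l - w l * P l)\<^sup>2 + (a1 l * p l + a0 l * p l) / 12" for l
  proof -
    have "(a1 l - a0 l) * q l \<le> \<bar>a1 l - a0 l\<bar> * p l"
      using q[of l] nn by (intro mult_mono) auto
    also have "\<dots> = \<bar>u l * P l - w l * P l\<bar> * \<bar>u l * P l + w l * P l\<bar>"
    proof -
      have "(a1 l - a0 l) * p l = (u l * P l - w l * P l) * (u l * P l + w l * P l)"
        unfolding sq by (simp add: power2_eq_square algebra_simps)
      then show ?thesis using nn(3)[of l] by (metis abs_mult abs_of_nonneg)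
    qed
    also have "\<dots> \<le> 6 * (u l * P l - w l * P l)\<^sup>2 + (u l * P l + w l * P l)\<^sup>2 / 24"
    proof -
      have "0 \<le> (12 * \<bar>u l * P l - w l * P l\<bar> - \<bar>u l * P l + w l * P l\<bar>)\<^sup>2" by simp
      also have "\<dots> = 144 * (u l * P l - w l * P l)\<^sup>2 + (u l * P l + w l * P l)\<^sup>2
          - 24 * (\<bar>u l * P l - w l * P l\<bar> * \<bar>u l * P l + w l * P l\<bar>)"
        unfolding power2_diff power_mult_distrib power2_abs by simp
      finally show ?thesis by simp
    qed
    also have "\<dots> \<le> 6 * (u l * P l - w l * P l)\<^sup>2 + (a1 l * p l + a0 l * p l) / 12"
      using two[of "u l * P l" "w l * P l"] unfolding sq by (simp add: power_mult_distrib)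
    finally show ?thesis .
  qed
  then have "(\<Sum>l\<in>L. (a1 l - a0 l) * q l) 
      \<le> (\<Sum>l\<in>L. 6 * (u l * P l - w l * P l)\<^sup>2 + (a1 l * p l + a0 l * p l) / 12)"
    by (intro sum_mono)
  also have "\<dots> = 6 * C + 1 / 6"
    by (simp add: C_def sum.distrib sum_distrib_left sum_divide_distrib[symmetric] n1)
  also have "\<dots> \<le> 36 * (A + B) + 1 / 6" using C nAB by simp
  also have "A + B = (\<Sum>l\<in>L. r l * (sqrt (a1 l) - sqrt (a0 l))\<^sup>2 + a0 l * (sqrt (r l) - sqrt (p l))\<^sup>2)"
    unfolding A_def B_def sum.distrib[symmetric] u_def[symmetric] w_def[symmetric] P_def[symmetric]
      R_def[symmetric]
    unfolding sq by (intro sum.cong) (auto simp: power2_eq_square algebra_simps)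
  finally show ?thesis .
qed

text \<open>The transcript \<open>l\<close> has probability \<open>F l * G l\<close>, and the
  entropy term of a product splits into those of the two factors. The level-one inequality applies
  to each party separately, and \<open>gibbs\<close> bounds the total entropy.\<close>

lemma transcript_entropy:
  fixes f g :: "'l \<Rightarrow> ('j \<Rightarrow> bool) \<Rightarrow> real"
  assumes "finite J" "finite L"
    and f: "\<And>l u. 0 \<le> f l u" "\<And>l u. f l u \<le> 1" and g: "\<And>l u. 0 \<le> g l u" "\<And>l u. g l u \<le> 1"
    and one: "(\<Sum>l\<in>L. avg J (f l) * avg J (g l)) = 1"
    and W: "\<And>l. l \<in> L \<Longrightarrow> 0 < W l" "(\<Sum>l\<in>L. W l) \<le> 1"
  shows "(\<Sum>l\<in>L. \<Sum>j\<in>J. 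
      avg J (g l) * ((avg J (\<lambda>u. sign_of (u j) * f l u))\<^sup>2 / (2 * avg J (f l))) +
      avg J (f l) * ((avg J (\<lambda>u. sign_of (u j) * g l u))\<^sup>2 / (2 * avg J (g l))))
    \<le> (\<Sum>l\<in>L. avg J (f l) * avg J (g l) * ln (1 / W l))"
proof -
  define F G where "F l = avg J (f l)" and "G l = avg J (g l)" for l
  have nn: "0 \<le> F l" "0 \<le> G l" for l
    unfolding F_def G_def by (auto intro!: avg_nonneg f g)
  have "(\<Sum>l\<in>L. \<Sum>j\<in>J. 
      G l * ((avg J (\<lambda>u. sign_of (u j) * f l u))\<^sup>2 / (2 * F l)) +
      F l * ((avg J (\<lambda>u. sign_of (u j) * g l u))\<^sup>2 / (2 * G l)))
    \<le> (\<Sum>l\<in>L. - (F l * G l) * ln (F l * G l))"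
  proof (intro sum_mono)
    fix l
    have 1: "(\<Sum>j\<in>J. (avg J (\<lambda>u. sign_of (u j) * f l u))\<^sup>2 / (2 * F l)) \<le> - F l * ln (F l)"
      unfolding F_def by (intro level1_inequality_bounded assms)
    have 2: "(\<Sum>j\<in>J. (avg J (\<lambda>u. sign_of (u j) * g l u))\<^sup>2 / (2 * G l)) \<le> - G l * ln (G l)"
      unfolding G_def by (intro level1_inequality_bounded assms)
    have "(\<Sum>j\<in>J. G l * ((avg J (\<lambda>u. sign_of (u j) * f l u))\<^sup>2 / (2 * F l)) +
      F l * ((avg J (\<lambda>u. sign_of (u j) * g l u))\<^sup>2 / (2 * G l)))
      \<le> G l * (- F l * ln (F l)) + F l * (- G l * ln (G l))"
      unfolding sum.distrib sum_distrib_left[symmetric]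
      by (intro add_mono mult_left_mono 1 2 nn)
    also have "\<dots> = - (F l * G l) * ln (F l * G l)"
      using nn[of l] by (cases "F l = 0 \<or> G l = 0") (auto simp: ln_mult algebra_simps)
    finally show "(\<Sum>j\<in>J. G l * ((avg J (\<lambda>u. sign_of (u j) * f l u))\<^sup>2 / (2 * F l)) +
      F l * ((avg J (\<lambda>u. sign_of (u j) * g l u))\<^sup>2 / (2 * G l))) \<le> - (F l * G l) * ln (F l * G l)" .
  qed
  also have "\<dots> \<le> (\<Sum>l\<in>L. F l * G l * ln (1 / W l))"
    by (rule gibbs) (use assms nn in \<open>auto simp: F_def G_def\<close>)
  finally show ?thesis unfolding F_def G_def .
qed

text \<open>
  Given \<open>d\<close>, the edge bit depends only on \<open>u\<close> and the pair of types only on \<open>t\<close>, so the two are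
  independent although they are correlated in the base distribution, which is recovered by averaging
  over \<open>d\<close>.  The edge bit is random only for \<open>d = (True, False, True)\<close>, the types only for
  \<open>d = (True, True, _)\<close>.
\<close>

fun seed_x :: "bool \<times> bool \<times> bool \<Rightarrow> bool \<Rightarrow> bool" where
  "seed_x (d1, d2, d3) u \<longleftrightarrow> d1 \<and> \<not> d2 \<and> d3 \<and> u"

fun seed_y :: "bool \<times> bool \<times> bool \<Rightarrow> bool \<Rightarrow> bool \<times> bool" where
  "seed_y (d1, d2, d3) t = (if d1 then if d2 then (t, t) else (d3, d3) else (d2, \<not> d2))"

text \<open>
  Two coins are used because this decomposition needs an edge probability below \<open>1 / 2\<close>: the case
  that both types are \<open>True\<close> and the edge is absent is shared between the two kinds of \<open>d\<close>.
\<close>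

fun base_x :: "bool \<times> bool \<times> bool \<times> bool \<Rightarrow> bool" where
  "base_x (v, c, r1, r2) \<longleftrightarrow> v \<and> c \<and> r1 \<and> r2"

fun base_y :: "bool \<times> bool \<times> bool \<times> bool \<Rightarrow> bool \<times> bool" where
  "base_y (v, c, r1, r2) = (v, c)"

text \<open>Used to unfold sums over seeds into sums over single bits.\<close>

lemma sum_UNIV_prod: 
  "(\<Sum>z\<in>(UNIV :: ('a::finite \<times> 'b::finite) set). f z) = (\<Sum>a\<in>UNIV. \<Sum>b\<in>UNIV. f (a, b))"
  by (simp add: sum.cartesian_product UNIV_Times_UNIV)

text \<open>In one coordinate both sides give probability 1/16 to types \<open>(True, True)\<close>
  with the edge, 3/16 to \<open>(True, True)\<close> without it, and 1/4 without the edge to each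
  other pair of types. Pairing the two arguments of \<open>F\<close> lets
  \<open>avg_transport3\<close> lift this to all coordinates.\<close>

lemma avg_seed:
  assumes "finite J"
  shows "avg J (\<lambda>D. avg J (\<lambda>u. avg J (\<lambda>t. 
      F (\<lambda>j\<in>J. seed_x (D j) (u j)) (\<lambda>j\<in>J. seed_y (D j) (t j)))))
    = avg J (\<lambda>z. F (\<lambda>j\<in>J. base_x (z j)) (\<lambda>j\<in>J. base_y (z j)))"
proof -
  have r: "restrict (\<lambda>j. fst (restrict (\<lambda>j. (p j, q j)) J j)) J = restrict p J"
    "restrict (\<lambda>j. snd (restrict (\<lambda>j. (p j, q j)) J j)) J = restrict q J"
    for p :: "'a \<Rightarrow> bool" and q :: "'a \<Rightarrow> bool \<times> bool"
    by (auto simp: restrict_def fun_eq_iff)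
  have "avg J (\<lambda>D. avg J (\<lambda>u. avg J (\<lambda>t. 
      (\<lambda>w. F (\<lambda>j\<in>J. fst (w j)) (\<lambda>j\<in>J. snd (w j))) (\<lambda>j\<in>J. (seed_x (D j) (u j), seed_y (D j) (t j))))))
    = avg J (\<lambda>z. (\<lambda>w. F (\<lambda>j\<in>J. fst (w j)) (\<lambda>j\<in>J. snd (w j))) (\<lambda>j\<in>J. (base_x (z j), base_y (z j))))"
    by (rule avg_transport3[OF assms, where f = "\<lambda>d u t. (seed_x d u, seed_y d t)" 
          and g = "\<lambda>z. (base_x z, base_y z)"])
       (simp add: sum_UNIV_prod UNIV_bool field_simps)
  then show ?thesis unfolding r .
qed

lemma avg_fixed_coordinate:
  fixes f :: "('j \<Rightarrow> bool) \<Rightarrow> real"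
  assumes "finite J" "j \<in> J"
  defines "f' c \<equiv> avg J (\<lambda>u. f (u(j := c)))"
  shows "avg J f = (f' True + f' False) / 2"
    and "avg J (\<lambda>u. sign_of (u j) * f u) = (f' True - f' False) / 2"
proof -
  show "avg J f = (f' True + f' False) / 2"
    by (subst avg_resample[OF assms(1,2)]) (simp add: UNIV_bool f'_def add.commute)
  show "avg J (\<lambda>u. sign_of (u j) * f u) = (f' True - f' False) / 2"
    by (subst avg_resample[OF assms(1,2)])
       (simp add: UNIV_bool f'_def avg_cmult[where c = "-1", simplified])
qed

text \<open>Here \<open>a\<close> and \<open>b\<close> are the probabilities that the parties are
  consistent with a transcript, and \<open>q\<close> also asks that position \<open>j\<close> is
  reported. The left side is the total advantage in telling whether an edge is planted at types
  \<open>(False, False)\<close>, a combination outside the base distribution. Direct sum argument: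
  \<open>transcript_entropy\<close> bounds the information summed over all positions, and
  \<open>cut_paste\<close> makes every single advantage cost information.\<close>

lemma two_party:
  fixes a :: "'l \<Rightarrow> ('j \<Rightarrow> bool) \<Rightarrow> real" and b :: "'l \<Rightarrow> ('j \<Rightarrow> bool \<times> bool) \<Rightarrow> real"
    and q :: "'l \<Rightarrow> 'j \<Rightarrow> ('j \<Rightarrow> bool \<times> bool) \<Rightarrow> real" and W :: "'l \<Rightarrow> real"
  assumes fin: "finite J" "finite L"
    and a: "\<And>l x. 0 \<le> a l x" "\<And>l x. a l x \<le> 1" and b: "\<And>l y. 0 \<le> b l y" "\<And>l y. b l y \<le> 1"
    and one: "\<And>x y. (\<Sum>l\<in>L. a l x * b l y) = 1"
    and q: "\<And>l j y. 0 \<le> q l j y" "\<And>l j y. q l j y \<le> b l y"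
    and W: "\<And>l. l \<in> L \<Longrightarrow> 0 < W l" "(\<Sum>l\<in>L. W l) \<le> 1"
  defines "X z \<equiv> \<lambda>j\<in>J. base_x (z j)" and "Y z \<equiv> \<lambda>j\<in>J. base_y (z j)"
  shows "(\<Sum>j\<in>J. avg J (\<lambda>z. \<Sum>l\<in>L. (a l ((X z)(j := True)) - a l ((X z)(j := False))) * 
      q l j ((Y z)(j := (False, False)))))
    \<le> 1152 * avg J (\<lambda>z. \<Sum>l\<in>L. a l (X z) * b l (Y z) * ln (1 / W l)) + card J / 6"
proof -
  define sx where "sx D u = (\<lambda>j\<in>J. seed_x (D j) (u j))" for D u
  define sy where "sy D t = (\<lambda>j\<in>J. seed_y (D j) (t j))" for D t
  have seed: "avg J (\<lambda>z. F (X z) (Y z)) = avg J (\<lambda>D. avg J (\<lambda>u. avg J (\<lambda>t. F (sx D u) (sy D t))))" for F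
    unfolding X_def Y_def sx_def sy_def by (rule avg_seed[OF fin(1), symmetric])
  define f where "f D l = (\<lambda>u. a l (sx D u))" for D l
  define g where "g D l = (\<lambda>t. b l (sy D t))" for D l
  define ax where "ax D j c l = avg J (\<lambda>u. a l ((sx D u)(j := c)))" for D j c l
  define by' where "by' D j c l = avg J (\<lambda>t. b l ((sy D t)(j := (c, c))))" for D j c l
  define h where "h D j l = avg J (g D l) * ((avg J (\<lambda>u. sign_of (u j) * f D l u))\<^sup>2 / (2 * avg J (f D l))) +
      avg J (f D l) * ((avg J (\<lambda>u. sign_of (u j) * g D l u))\<^sup>2 / (2 * avg J (g D l)))" for D j l
  have fnn: "0 \<le> avg J (f D l)" "0 \<le> avg J (g D l)" for D l
    unfolding f_def g_def by (auto intro!: avg_nonneg a b)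
  have hnn: "0 \<le> h D j l" for D j l
    unfolding h_def using fnn by (intro add_nonneg_nonneg mult_nonneg_nonneg divide_nonneg_nonneg) auto
  have axnn: "0 \<le> ax D j c l" "0 \<le> by' D j c l" for D j c l
    unfolding ax_def by'_def by (auto intro!: avg_nonneg a b)
  have prod1: "(\<Sum>l\<in>L. avg J (\<lambda>u. a l (\<phi> u)) * avg J (\<lambda>t. b l (\<psi> t))) = 1" 
    for \<phi> :: "('j \<Rightarrow> bool) \<Rightarrow> _" and \<psi> :: "('j \<Rightarrow> bool) \<Rightarrow> _"
  proof -
    have "(\<Sum>l\<in>L. avg J (\<lambda>u. a l (\<phi> u)) * avg J (\<lambda>t. b l (\<psi> t)))
        = avg J (\<lambda>u. avg J (\<lambda>t. \<Sum>l\<in>L. a l (\<phi> u) * b l (\<psi> t)))"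
      by (simp add: avg_sum avg_cmult avg_multc)
    also have "\<dots> = 1" using fin by (simp add: one)
    finally show ?thesis .
  qed
  have ent: "(\<Sum>l\<in>L. \<Sum>j\<in>J. h D j l) \<le> (\<Sum>l\<in>L. avg J (f D l) * avg J (g D l) * ln (1 / W l))" for D
    unfolding h_def
    by (rule transcript_entropy[OF fin _ _ _ _ _ W]) (auto simp: f_def g_def a b prod1)
  have "avg J (\<lambda>D. \<Sum>l\<in>L. \<Sum>j\<in>J. h D j l) 
      \<le> avg J (\<lambda>D. \<Sum>l\<in>L. avg J (f D l) * avg J (g D l) * ln (1 / W l))"
    by (intro avg_mono ent)
  also have "\<dots> = avg J (\<lambda>z. \<Sum>l\<in>L. a l (X z) * b l (Y z) * ln (1 / W l))"
    by (subst seed[where F = "\<lambda>x y. \<Sum>l\<in>L. a l x * b l y * ln (1 / W l)"])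
       (simp add: avg_sum avg_cmult avg_multc f_def g_def mult.assoc)
  finally have total: "avg J (\<lambda>D. \<Sum>l\<in>L. \<Sum>j\<in>J. h D j l) \<le> \<dots>" .

  define adv where "adv D j = (\<Sum>l\<in>L. (ax D j True l - ax D j False l) * 
      avg J (\<lambda>t. q l j ((sy D t)(j := (False, False)))))" for D j
  have adv_le: "adv D j \<le> 36 * (\<Sum>l\<in>L. by' D j True l * (sqrt (ax D j True l) - sqrt (ax D j False l))\<^sup>2 
      + ax D j False l * (sqrt (by' D j True l) - sqrt (by' D j False l))\<^sup>2) + 1 / 6" for D j
    unfolding adv_def
    by (rule cut_paste) (auto simp: axnn, auto simp: ax_def by'_def prod1 intro!: avg_nonneg avg_mono q)
  \<comment> \<open>For this value at \<open>j\<close> the types are \<open>(True, True)\<close> and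
    the edge bit is \<open>u j\<close>, so \<open>h\<close> dominates the first Hellinger term of
    \<open>cut_paste\<close>.\<close>
  have hA: "h (D(j := (True, False, True))) j l 
      \<ge> by' D j True l * (sqrt (ax D j True l) - sqrt (ax D j False l))\<^sup>2 / 4" if "j \<in> J" for D j l
  proof -
    let ?D = "D(j := (True, False, True))"
    have s: "sx ?D (u(j := c)) = (sx D u)(j := c)" "sy ?D t = (sy D t)(j := (True, True))" for u c t
      using that by (auto simp: sx_def sy_def restrict_def fun_eq_iff)
    have g: "avg J (g ?D l) = by' D j True l"
      by (simp add: g_def by'_def s)
    have f: "avg J (f ?D l) = (ax D j True l + ax D j False l) / 2"
      "avg J (\<lambda>u. sign_of (u j) * f ?D l u) = (ax D j True l - ax D j False l) / 2"
      using avg_fixed_coordinate[OF fin(1) that, of "f ?D l"] by (simp_all add: f_def ax_def s)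
    have "by' D j True l * ((sqrt (ax D j True l) - sqrt (ax D j False l))\<^sup>2 / 4) 
      \<le> by' D j True l * (((ax D j True l - ax D j False l) / 2)\<^sup>2 / (2 * ((ax D j True l + ax D j False l) / 2)))"
      by (intro mult_left_mono hellinger_le axnn)
    also have "\<dots> \<le> h ?D j l"
      unfolding h_def f g by (rule le_add_same_cancel1[THEN iffD2]) (simp add: axnn)
    finally show ?thesis by simp
  qed
  \<comment> \<open>For this value at \<open>j\<close> the edge is absent and the types are both
    \<open>t j\<close>, which gives the second Hellinger term.\<close>
  have hB: "h (D(j := (True, True, True))) j l 
      \<ge> ax D j False l * (sqrt (by' D j True l) - sqrt (by' D j False l))\<^sup>2 / 4" if "j \<in> J" for D j l
  proof -
    let ?D = "D(j := (True, True, True))"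
    have s: "sy ?D (t(j := c)) = (sy D t)(j := (c, c))" "sx ?D u = (sx D u)(j := False)" for u c t
      using that by (auto simp: sx_def sy_def restrict_def fun_eq_iff)
    have f: "avg J (f ?D l) = ax D j False l"
      by (simp add: f_def ax_def s)
    have g: "avg J (g ?D l) = (by' D j True l + by' D j False l) / 2"
      "avg J (\<lambda>u. sign_of (u j) * g ?D l u) = (by' D j True l - by' D j False l) / 2"
      using avg_fixed_coordinate[OF fin(1) that, of "g ?D l"] by (simp_all add: g_def by'_def s)
    have "ax D j False l * ((sqrt (by' D j True l) - sqrt (by' D j False l))\<^sup>2 / 4) 
      \<le> ax D j False l * (((by' D j True l - by' D j False l) / 2)\<^sup>2 / (2 * ((by' D j True l + by' D j False l) / 2)))"
      by (intro mult_left_mono hellinger_le axnn)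
    also have "\<dots> \<le> h ?D j l"
      unfolding h_def f g by (rule le_add_same_cancel2[THEN iffD2]) (simp add: axnn)
    finally show ?thesis by simp
  qed
  \<comment> \<open>The constant is 36 from \<open>cut_paste\<close>, times 4 from
    \<open>hellinger_le\<close>, times 8 because each value of \<open>D j\<close> has probability
    1/8. Replacing \<open>D j\<close> is legitimate since \<open>adv D j\<close> overwrites
    coordinate \<open>j\<close> in both inputs.\<close>
  have step: "avg J (\<lambda>D. adv D j) \<le> 1152 * avg J (\<lambda>D. \<Sum>l\<in>L. h D j l) + 1 / 6" if j: "j \<in> J" for j
  proof -
    define H where "H D = (\<Sum>l\<in>L. h D j l)" for D
    have Hnn: "0 \<le> H D" for D unfolding H_def by (intro sum_nonneg hnn)
    have HA: "H (D(j := (True, False, True))) + H (D(j := (True, True, True))) \<ge> 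
      (\<Sum>l\<in>L. by' D j True l * (sqrt (ax D j True l) - sqrt (ax D j False l))\<^sup>2 
      + ax D j False l * (sqrt (by' D j True l) - sqrt (by' D j False l))\<^sup>2) / 4" for D
      unfolding H_def sum.distrib[symmetric] sum_divide_distrib
      by (intro sum_mono) (use hA[OF j, of D] hB[OF j, of D] in \<open>simp add: add_divide_distrib add_mono\<close>)
    have "(\<Sum>d\<in>{(True, False, True), (True, True, True)}. avg J (\<lambda>D. H (D(j := d))))
        \<le> (\<Sum>d\<in>UNIV. avg J (\<lambda>D. H (D(j := d))))"
      by (intro sum_mono2) (auto intro!: avg_nonneg Hnn)
    also have "\<dots> = 8 * avg J H"
      by (subst avg_resample[OF fin(1) j, of H]) (simp add: UNIV_bool card_prod)
    finally have H8: "avg J (\<lambda>D. H (D(j := (True, False, True))) + H (D(j := (True, True, True)))) \<le> 8 * avg J H"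
      by (simp add: avg_add)
    have "avg J (\<lambda>D. adv D j) \<le> avg J (\<lambda>D. 144 * (H (D(j := (True, False, True))) + H (D(j := (True, True, True)))) + 1 / 6)"
    proof (intro avg_mono)
      fix D
      show "adv D j \<le> 144 * (H (D(j := (True, False, True))) + H (D(j := (True, True, True)))) + 1 / 6"
        using adv_le[of D j] HA[of D] by argo
    qed
    also have "\<dots> \<le> 1152 * avg J H + 1 / 6"
      using H8 fin by (simp only: avg_add[of J _ "\<lambda>_. 1 / 6"] avg_cmult avg_const)
    finally show ?thesis unfolding H_def .
  qed
  have "(\<Sum>j\<in>J. avg J (\<lambda>z. \<Sum>l\<in>L. (a l ((X z)(j := True)) - a l ((X z)(j := False))) * 
      q l j ((Y z)(j := (False, False))))) = (\<Sum>j\<in>J. avg J (\<lambda>D. adv D j))"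
  proof (intro sum.cong refl)
    fix j
    show "avg J (\<lambda>z. \<Sum>l\<in>L. (a l ((X z)(j := True)) - a l ((X z)(j := False))) * 
      q l j ((Y z)(j := (False, False)))) = avg J (\<lambda>D. adv D j)"
      by (subst seed[where F = "\<lambda>x y. \<Sum>l\<in>L. (a l (x(j := True)) - a l (x(j := False))) * 
            q l j (y(j := (False, False)))"])
         (simp add: avg_sum avg_cmult avg_multc avg_diff adv_def ax_def)
  qed
  also have "\<dots> \<le> (\<Sum>j\<in>J. 1152 * avg J (\<lambda>D. \<Sum>l\<in>L. h D j l) + 1 / 6)"
    by (intro sum_mono step)
  also have "\<dots> = 1152 * avg J (\<lambda>D. \<Sum>l\<in>L. \<Sum>j\<in>J. h D j l) + card J / 6"
    by (subst sum.swap) (simp add: sum.distrib sum_distrib_left avg_sum)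
  finally show ?thesis using total by simp
qed

section \<open>Runs of a protocol\<close>

definition next_message :: "nat \<Rightarrow> protocol \<Rightarrow> (nat \<Rightarrow> nat set set) \<Rightarrow> history \<Rightarrow> (nat \<times> message) option" where
  "next_message s P E h = (case coordinator P h of
      Send i b \<Rightarrow> if i < s then Some (i, To_Player b) else None
    | Receive i \<Rightarrow> if i < s then Some (i, From_Player (player P i (E i) (channel i h))) else None
    | Output H \<Rightarrow> None)"

lemma next_message_None:
  "next_message s P E h = None \<longleftrightarrow>
    (case coordinator P h of Send i b \<Rightarrow> \<not> i < s | Receive i \<Rightarrow> \<not> i < s | Output H \<Rightarrow> True)"
  by (simp add: next_message_def split: action.split)

lemma run_snoc: "run s P E (h @ [m]) \<longleftrightarrow> run s P E h \<and> next_message s P E h = Some m"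
proof
  assume "run s P E (h @ [m])"
  then show "run s P E h \<and> next_message s P E h = Some m"
    by (cases rule: run.cases) (auto simp: next_message_def)
next
  assume "run s P E h \<and> next_message s P E h = Some m"
  then show "run s P E (h @ [m])"
    by (auto simp: next_message_def split: action.splits if_splits intro: run.intros)
qed

lemma run_append: "run s P E (h @ h') \<Longrightarrow> run s P E h"
  by (induction h' rule: rev_induct) (auto simp: run_snoc simp flip: append_assoc)

text \<open>A run that has stopped, be it by an output or by being blocked.\<close>

definition final :: "nat \<Rightarrow> protocol \<Rightarrow> (nat \<Rightarrow> nat set set) \<Rightarrow> history \<Rightarrow> bool" where
  "final s P E f \<longleftrightarrow> run s P E f \<and> next_message s P E f = None"

text \<open>Runs are deterministic, so all histories on one input form a chain of prefixes.\<close>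

lemma run_prefix_final:
  assumes "run s P E h" "final s P E f"
  shows "prefix h f"
  using assms(1)
proof (induction h rule: rev_induct)
  case (snoc m h)
  then have h: "run s P E h" "next_message s P E h = Some m" "prefix h f"
    by (auto simp: run_snoc)
  then obtain g where g: "f = h @ g" by (auto simp: prefix_def)
  show ?case
  proof (cases g)
    case Nil
    then show ?thesis using h g assms(2) by (simp add: final_def)
  next
    case (Cons m' g')
    then have "run s P E (h @ [m'])"
      using assms(2) g run_append[of s P E "h @ [m']" g'] by (simp add: final_def)
    then show ?thesis using h g Cons by (auto simp: run_snoc)
  qed
qed simp

lemma final_unique: "final s P E f \<Longrightarrow> final s P E g \<Longrightarrow> f = g"
  by (meson final_def prefix_order.antisym run_prefix_final)

definition final_history :: "nat \<Rightarrow> protocol \<Rightarrow> (nat \<Rightarrow> nat set set) \<Rightarrow> history" where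
  "final_history s P E = (THE f. final s P E f)"

lemma final_history_eq: "final s P E f \<Longrightarrow> final_history s P E = f"
  unfolding final_history_def using final_unique by blast

lemma final_final_history:
  assumes "\<And>h. run s P E h \<Longrightarrow> length h \<le> T"
  shows "final s P E (final_history s P E)"
proof -
  have "\<exists>h. run s P E h \<and> (\<forall>g. run s P E g \<longrightarrow> length g \<le> length h)"
    using ex_has_greatest_nat[of "run s P E" "[]" length "Suc T"] run.start[of s P E] assms by (auto simp: less_Suc_eq_le)
  then obtain h where h: "run s P E h" "\<And>g. run s P E g \<Longrightarrow> length g \<le> length h" by blast
  have "next_message s P E h = None"
  proof (rule ccontr)
    assume "next_message s P E h \<noteq> None"
    then obtain m where "run s P E (h @ [m])" using h(1) by (auto simp: run_snoc)
    from h(2)[OF this] show False by simp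
  qed
  then have "final s P E h" using h(1) by (simp add: final_def)
  then show ?thesis using final_history_eq by metis
qed

lemma channel_Nil [simp]: "channel i [] = []"
  by (simp add: channel_def)

lemma channel_append [simp]: "channel i (g @ h) = channel i g @ channel i h"
  by (simp add: channel_def)

lemma channel_Cons: "channel i (x # h) = (if fst x = i then snd x # channel i h else channel i h)"
  by (auto simp: channel_def case_prod_unfold)

lemma sum_length_channel: "(\<Sum>i<s. length (channel i h)) \<le> length h"
proof (induction h)
  case (Cons x h)
  have "(\<Sum>i<s. length (channel i (x # h))) = (\<Sum>i<s. (if fst x = i then 1 else 0) + length (channel i h))"
    by (intro sum.cong) (auto simp: channel_Cons)
  also have "\<dots> \<le> 1 + length h"
    using Cons by (simp add: sum.distrib)
  finally show ?case by simp
qed simp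

text \<open>Here the privacy of channels enters: a player's bit depends on the past only through its
  own channel. This is what allows the bounds for the individual channels to be added up.\<close>

lemma player_bit_on_channel:
  assumes "run s P E h" "channel i h = c @ From_Player b # d"
  shows "b = player P i (E i) c"
  using assms
proof (induction arbitrary: d)
  case start
  then show ?case by simp
next
  case (send h k b')
  then have "channel i h @ channel i [(k, To_Player b')] = c @ From_Player b # d" by simp
  then show ?case using send
    by (cases "k = i"; cases d rule: rev_cases) (auto simp: channel_Cons)
next
  case (receive h k)
  show ?case
  proof (cases "k = i \<and> d = []")
    case True
    then show ?thesis using receive by (auto simp: channel_Cons)
  next
    case False
    then obtain d' where "channel i h = c @ From_Player b # d'"
      using receive.prems by (cases "k = i"; cases d rule: rev_cases) (auto simp: channel_Cons)
    then show ?thesis using receive.IH by blast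
  qed
qed

text \<open>The inputs with a given content of channel \<open>i\<close> form a combinatorial rectangle.\<close>

lemma final_rectangle:
  assumes f: "final s P E f" and g: "final s P E' g" and ch: "channel i f = channel i g"
  shows "final s P (E(i := E' i)) f"
proof -
  let ?E = "E(i := E' i)"
  \<comment> \<open>The bit also occurs in \<open>g\<close> after the same content \<open>c\<close>
    of channel \<open>i\<close>, where it was computed from \<open>E' i\<close>. All other steps of
    the run along \<open>f\<close> do not consult the edges of player \<open>i\<close>.\<close>
  have bit: "player P i (E i) c = player P i (E' i) c" if "channel i f = c @ From_Player (player P i (E i) c) # d" for c d
    using player_bit_on_channel[of s P E' g i c _ d] that g ch by (auto simp: final_def)
  have "run s P ?E h" if "run s P E h" for h
    using that
  proof (induction h rule: rev_induct)
    case (snoc m h)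
    then have h: "run s P E h" "next_message s P E h = Some m"
      by (auto simp: run_snoc)
    have h3: "run s P ?E h"
      by (rule snoc.IH) (rule h)
    have "next_message s P ?E h = Some m"
    proof (cases "coordinator P h = Receive i")
      case True
      then have m: "m = (i, From_Player (player P i (E i) (channel i h)))" "i < s"
        using h(2) by (auto simp: next_message_def split: if_splits)
      obtain d where "f = (h @ [m]) @ d"
        using run_prefix_final[OF snoc.prems f] by (auto simp: prefix_def)
      then have "channel i f = channel i h @ From_Player (player P i (E i) (channel i h)) # channel i d"
        by (simp add: m channel_Cons)
      from bit[OF this] show ?thesis using True m by (simp add: next_message_def)
    next
      case False
      then show ?thesis using h(2) by (auto simp: next_message_def split: action.splits)
    qed
    with h3 show ?case unfolding run_snoc ..
  qed (rule run.start)
  moreover have "next_message s P ?E f = None"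
    using f unfolding final_def next_message_None by blast
  ultimately show ?thesis using f by (simp add: final_def)
qed

text \<open>The output is a function of the final history alone, also for blocked runs, which get
  \<open>{}\<close>.\<close>

definition protocol_output :: "nat \<Rightarrow> protocol \<Rightarrow> (nat \<Rightarrow> nat set set) \<Rightarrow> nat set set" where
  "protocol_output s P E = (case coordinator P (final_history s P E) of Output H \<Rightarrow> H | _ \<Rightarrow> {})"

lemma outputs_protocol_output: "outputs s P E H \<Longrightarrow> protocol_output s P E = H"
proof -
  assume "outputs s P E H"
  then obtain h where h: "run s P E h" "coordinator P h = Output H" by (auto simp: outputs_def)
  then have "final s P E h" by (simp add: final_def next_message_def)
  then show ?thesis using h by (simp add: protocol_output_def final_history_eq)
qed

lemma UNIV_message: "(UNIV :: message set) = range To_Player \<union> range From_Player"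
proof -
  have "m \<in> range To_Player \<union> range From_Player" for m by (cases m) auto
  then show ?thesis by blast
qed

instance message :: finite
  by standard (simp add: UNIV_message)

lemma card_message: "CARD(message) = 4"
  unfolding UNIV_message
  by (subst card_Un_disjoint) (auto simp: card_image inj_def)

lemma finite_message_lists: "finite {l :: message list. length l \<le> T}"
  using finite_lists_length_le[of "UNIV :: message set" T] by simp

text \<open>The contents of a channel do not form a prefix-free code, hence the base \<open>8\<close> for lists over an
  alphabet of size \<open>4\<close>.\<close>

lemma message_list_weights: "(\<Sum>l\<in>{l :: message list. length l \<le> T}. (1 / 8) ^ length l / 2 :: real) \<le> 1"
proof -
  have "(\<Sum>l\<in>{l :: message list. length l \<le> T}. (1 / 8) ^ length l / 2 :: real)
      = (\<Sum>t\<le>T. \<Sum>l\<in>{l :: message list. length l = t}. (1 / 8) ^ length l / 2)"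
    by (subst sum.group[symmetric, where g = length and T = "{..T}"])
       (auto simp: finite_message_lists intro!: sum.cong arg_cong[where f = card])
  also have "\<dots> = (\<Sum>t\<le>T. (1 / 2) ^ t / 2)"
  proof (intro sum.cong refl)
    fix t
    have "card {l :: message list. length l = t} = 4 ^ t"
      using card_lists_length_eq[of "UNIV :: message set" t] by (simp add: card_message)
    then have "(\<Sum>l\<in>{l :: message list. length l = t}. (1 / 8) ^ length l / 2 :: real) = 4 ^ t * (1 / 8) ^ t / 2"
      by simp
    also have "(4 :: real) ^ t * (1 / 8) ^ t = (1 / 2) ^ t"
      unfolding power_mult_distrib[symmetric] by simp
    finally show "(\<Sum>l\<in>{l :: message list. length l = t}. (1 / 8) ^ length l / 2 :: real) = (1 / 2) ^ t / 2" .
  qed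
  also have "\<dots> = 1 - (1 / 2) ^ Suc T"
    by (induction T) (simp_all add: field_simps)
  finally show ?thesis by simp
qed

section \<open>The hard distribution\<close>

text \<open>The ends of an edge have distance at most 1 in \<open>G\<close>, hence at most 3 in
  \<open>H\<close>. The strict bound by 4 is what turns the infimum in \<open>graph_dist\<close>
  into an actual walk.\<close>

lemma spanner_short_walk:
  assumes "is_spanner 3 n G H" "u < n" "v < n" "{u, v} \<in> G"
  shows "\<exists>k\<le>3. (u, v) \<in> adj_rel H ^^ k"
proof -
  have "graph_dist G u v \<le> enat 1"
    unfolding graph_dist_def using assms(4) by (intro INF_lower) (simp add: adj_rel_def)
  then have "ereal_of_enat (graph_dist G u v) \<le> ereal 1"
    by (cases "graph_dist G u v") auto
  then have "ereal 3 * ereal_of_enat (graph_dist G u v) \<le> ereal 3 * ereal 1"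
    by (intro ereal_mult_left_mono) auto
  moreover have "ereal_of_enat (graph_dist H u v) \<le> ereal 3 * ereal_of_enat (graph_dist G u v)"
    using assms unfolding is_spanner_def by auto
  ultimately have "ereal_of_enat (graph_dist H u v) \<le> ereal 3"
    by (metis mult.right_neutral one_ereal_def order.trans)
  then have "graph_dist H u v < enat 4"
    by (cases "graph_dist H u v") auto
  then obtain k where "k < 4" "(u, v) \<in> adj_rel H ^^ k"
    unfolding graph_dist_def INF_less_iff by auto
  then show ?thesis by (intro exI[of _ k]) auto
qed

text \<open>
  The pair \<open>(P, Q)\<close> is a blob, so the copy \<open>v\<close> of \<open>P\<close> has an independent type \<open>Left_Type (P, Q) v\<close> in
  every blob of \<open>P\<close>.  The coins \<open>Coin _ i (P, Q) v\<close> belong to the edge of player \<open>i\<close> at \<open>v\<close>.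
\<close>

datatype coordinate = Left_Type "nat \<times> nat" nat | Right_Type "nat \<times> nat" nat 
  | Coin bool nat "nat \<times> nat" nat

locale blowup =
  fixes s N :: nat and R :: "(nat \<times> nat) set"
  assumes s_pos: "0 < s" and R_sub: "R \<subseteq> {..<N} \<times> {..<N}"
    and C4_free: "\<lbrakk>(P, Q) \<in> R; (P', Q) \<in> R; (P, Q') \<in> R; (P', Q') \<in> R\<rbrakk> \<Longrightarrow> P = P' \<or> Q = Q'"
begin

text \<open>Blocks of \<open>s\<close> consecutive numbers, first for the \<open>N\<close> left
  vertices of \<open>R\<close>, then for the \<open>N\<close> right ones. A left vertex is thus
  always the smaller end of an edge.\<close>

definition left_vertex :: "nat \<Rightarrow> nat \<Rightarrow> nat" where "left_vertex P v = s * P + v"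

definition right_vertex :: "nat \<Rightarrow> nat \<Rightarrow> nat" where "right_vertex Q c = s * (N + Q) + c"

lemma left_vertex_inj: "v < s \<Longrightarrow> v' < s \<Longrightarrow> left_vertex P v = left_vertex P' v' \<longleftrightarrow> P = P' \<and> v = v'"
  unfolding left_vertex_def by (metis add_diff_cancel_left' add.commute div_mult_self4 div_less nat_less_le 
      div_mult_self2 less_nat_zero_code add_0)

lemma right_vertex_inj: "c < s \<Longrightarrow> c' < s \<Longrightarrow> right_vertex Q c = right_vertex Q' c' \<longleftrightarrow> Q = Q' \<and> c = c'"
  using left_vertex_inj[of c c' "N + Q" "N + Q'"] by (simp add: left_vertex_def right_vertex_def)

lemma left_neq_right: "P < N \<Longrightarrow> v < s \<Longrightarrow> left_vertex P v < right_vertex Q c"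
proof -
  assume "P < N" "v < s"
  then have "s * P + v < s * (P + 1)" by simp
  also have "\<dots> \<le> s * (N + Q)" using \<open>P < N\<close> by (intro mult_le_mono2) auto
  finally show ?thesis by (simp add: left_vertex_def right_vertex_def)
qed

lemma right_vertex_less: "Q < N \<Longrightarrow> c < s \<Longrightarrow> right_vertex Q c < 2 * N * s"
proof -
  assume "Q < N" "c < s"
  then have "s * (N + Q) + c < s * (N + Q + 1)" by simp
  also have "\<dots> \<le> s * (2 * N)" using \<open>Q < N\<close> by (intro mult_le_mono2) auto
  finally show ?thesis by (simp add: right_vertex_def ac_simps)
qed

definition all_blobs :: "nat set set" where
  "all_blobs = {{left_vertex P v, right_vertex Q c} | P Q v c. (P, Q) \<in> R \<and> v < s \<and> c < s}"

lemma blob_edge_eq: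
  assumes "P < N" "P' < N" "v < s" "v' < s" "c < s" "c' < s"
  shows "{left_vertex P v, right_vertex Q c} = {left_vertex P' v', right_vertex Q' c'}
    \<longleftrightarrow> P = P' \<and> v = v' \<and> Q = Q' \<and> c = c'"
  using left_neq_right[of P v Q' c'] left_neq_right[of P' v' Q c] left_vertex_inj[of v v' P P']
    right_vertex_inj[of c c' Q Q'] assms
  by (auto simp: doubleton_eq_iff)

lemma left_neighbour:
  assumes "(left_vertex P v, y) \<in> adj_rel G" "G \<subseteq> all_blobs" "P < N" "v < s"
  obtains Q c where "(P, Q) \<in> R" "c < s" "y = right_vertex Q c" "{left_vertex P v, right_vertex Q c} \<in> G"
proof -
  obtain P' Q v' c where e: "{left_vertex P v, y} = {left_vertex P' v', right_vertex Q c}" 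
    "(P', Q) \<in> R" "v' < s" "c < s" "{left_vertex P v, y} \<in> G"
    using assms by (auto simp: adj_rel_def all_blobs_def)
  then show ?thesis
    using that[of Q c] left_neq_right[of P v Q c] left_vertex_inj[of v v' P P'] assms
    by (auto simp: doubleton_eq_iff)
qed

lemma right_neighbour:
  assumes "(right_vertex Q c, y) \<in> adj_rel G" "G \<subseteq> all_blobs" "c < s"
  obtains P v where "(P, Q) \<in> R" "v < s" "y = left_vertex P v" "{left_vertex P v, right_vertex Q c} \<in> G"
proof -
  obtain P v Q' c' where e: "{right_vertex Q c, y} = {left_vertex P v, right_vertex Q' c'}" 
    "(P, Q') \<in> R" "v < s" "c' < s" "{right_vertex Q c, y} \<in> G"
    using assms by (auto simp: adj_rel_def all_blobs_def)
  then show ?thesis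
    using that[of P v] left_neq_right[of P v Q c] right_vertex_inj[of c c' Q Q'] assms R_sub
    by (auto simp: doubleton_eq_iff insert_commute)
qed

text \<open>A path of length 3 between the ends of an edge projects to a closed walk of length 4 in \<open>R\<close>,
  which is degenerate since \<open>R\<close> has no 4-cycle; so it uses an edge of the same blob at one of the
  two ends.\<close>

lemma isolated_edge_in_spanner:
  assumes sp: "is_spanner 3 n G H" and n: "2 * N * s \<le> n" and G: "G \<subseteq> all_blobs"
    and PQ: "(P, Q) \<in> R" "v < s" "c < s" and e: "{left_vertex P v, right_vertex Q c} \<in> G"
    and iso: "\<And>w. w < s \<Longrightarrow> {left_vertex P w, right_vertex Q c} \<in> G \<Longrightarrow> w = v"
      "\<And>d. d < s \<Longrightarrow> {left_vertex P v, right_vertex Q d} \<in> G \<Longrightarrow> d = c"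
  shows "{left_vertex P v, right_vertex Q c} \<in> H"
proof -
  have N: "P < N" "Q < N" using PQ R_sub by auto
  have HG: "H \<subseteq> G" using sp by (simp add: is_spanner_def)
  then have H: "H \<subseteq> all_blobs" using G by blast
  have neq: "left_vertex P' v' \<noteq> right_vertex Q' c'" if "(P', Q'') \<in> R" "v' < s" for P' Q'' v' Q' c'
    using left_neq_right[of P' v' Q' c'] that R_sub by auto
  have "right_vertex Q c < n" using right_vertex_less[OF N(2) PQ(3)] n by simp
  moreover then have "left_vertex P v < n" using left_neq_right[OF N(1) PQ(2), of Q c] by simp
  ultimately obtain k where k: "k \<le> 3" "(left_vertex P v, right_vertex Q c) \<in> adj_rel H ^^ k"
    using spanner_short_walk[OF sp _ _ e] by blast
  consider "k = 0" | "k = Suc 0" | "k = Suc (Suc 0)" | "k = Suc (Suc (Suc 0))"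
    using k(1) by linarith
  then show ?thesis
  proof cases
    case 1
    then show ?thesis using k neq[OF PQ(1,2)] by auto
  next
    case 2
    then show ?thesis using k by (auto simp: adj_rel_def)
  next
    \<comment> \<open>Impossible by parity: two steps lead back to the left side.\<close>
    case 3
    then obtain y where y: "(left_vertex P v, y) \<in> adj_rel H" "(y, right_vertex Q c) \<in> adj_rel H"
      using k by auto
    obtain Q1 c1 where 1: "c1 < s" "y = right_vertex Q1 c1"
      using left_neighbour[OF y(1) H N(1) PQ(2)] by metis
    from right_neighbour[OF y(2)[unfolded 1(2)] H 1(1)] neq show ?thesis by metis
  next
    case 4
    then obtain y z where y: "(left_vertex P v, y) \<in> adj_rel H" "(y, z) \<in> adj_rel H" 
        "(z, right_vertex Q c) \<in> adj_rel H"
      using k by auto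
    obtain Q1 c1 where 1: "(P, Q1) \<in> R" "c1 < s" "y = right_vertex Q1 c1" 
        "{left_vertex P v, right_vertex Q1 c1} \<in> H"
      using left_neighbour[OF y(1) H N(1) PQ(2)] by metis
    obtain P1 v1 where 2: "(P1, Q1) \<in> R" "v1 < s" "z = left_vertex P1 v1" 
      using right_neighbour[OF y(2)[unfolded 1(3)] H 1(2)] by metis
    have P1: "P1 < N" using 2 R_sub by auto
    obtain Q2 c2 where 3: "(P1, Q2) \<in> R" "c2 < s" "right_vertex Q c = right_vertex Q2 c2" 
        "{left_vertex P1 v1, right_vertex Q2 c2} \<in> H"
      using left_neighbour[OF y(3)[unfolded 2(3)] H P1 2(2)] by metis
    have Q2: "Q2 = Q" "c2 = c" using right_vertex_inj[OF PQ(3) 3(2)] 3(3) by auto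
    from C4_free[OF PQ(1) 3(1)[unfolded Q2] 1(1) 2(1)] show ?thesis
    proof
      assume "P = P1"
      then show ?thesis using iso(1)[OF 2(2)] 3(4) HG Q2 by auto
    next
      assume "Q = Q1"
      then show ?thesis using iso(2)[OF 1(2)] 1(4) HG by auto
    qed
  qed
qed

section \<open>Random inputs and the view of one player\<close>

definition positions :: "((nat \<times> nat) \<times> nat) set" where "positions = R \<times> {..<s}"

text \<open>The \<open>i\<close>-th perfect matching of a blob joins \<open>v\<close> to
  \<open>v + i\<close> modulo \<open>s\<close>; these \<open>s\<close> matchings partition K(s,
  s).\<close>

definition shift :: "nat \<Rightarrow> nat \<Rightarrow> nat" where "shift i v = (v + i) mod s"

text \<open>Inverse of \<open>shift i\<close>, adding \<open>s - i\<close> so that the natural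
  subtraction is exact for \<open>i < s\<close>.\<close>

definition unshift :: "nat \<Rightarrow> nat \<Rightarrow> nat" where "unshift i c = (c + (s - i)) mod s"

lemma shift_less [simp]: "shift i v < s" "unshift i c < s"
  using s_pos by (simp_all add: shift_def unshift_def)

lemma shift_eq: "v < s \<Longrightarrow> i < s \<Longrightarrow> shift i v = (if v + i < s then v + i else v + i - s)"
  by (simp add: shift_def le_mod_geq)

lemma unshift_eq: "c < s \<Longrightarrow> i < s \<Longrightarrow> unshift i c = (if c < i then c + s - i else c - i)"
  by (auto simp: unshift_def le_mod_geq)

lemma unshift_shift [simp]: "v < s \<Longrightarrow> i < s \<Longrightarrow> unshift i (shift i v) = v"
  by (subst unshift_eq) (auto simp: shift_eq)

lemma shift_unshift [simp]: "c < s \<Longrightarrow> i < s \<Longrightarrow> shift i (unshift i c) = c"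
  by (subst shift_eq) (auto simp: unshift_eq)

lemma shift_inj: "v < s \<Longrightarrow> w < s \<Longrightarrow> i < s \<Longrightarrow> shift i v = shift i w \<longleftrightarrow> v = w"
  by (metis unshift_shift)

lemma shift_inj2: "v < s \<Longrightarrow> i < s \<Longrightarrow> k < s \<Longrightarrow> shift i v = shift k v \<longleftrightarrow> i = k"
  by (auto simp: shift_eq split: if_splits)

fun edge :: "nat \<Rightarrow> (nat \<times> nat) \<times> nat \<Rightarrow> nat set" where
  "edge i ((P, Q), v) = {left_vertex P v, right_vertex Q (shift i v)}"

text \<open>An edge determines its blob and its ends, and the difference of the ends modulo
  \<open>s\<close> determines the player. This is the reason that no edge is held twice.\<close>

lemma edge_eq:
  assumes "j \<in> positions" "j' \<in> positions" "i < s" "k < s"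
  shows "edge i j = edge k j' \<longleftrightarrow> i = k \<and> j = j'"
proof -
  obtain P Q v where j: "j = ((P, Q), v)" by (metis surj_pair)
  obtain P' Q' v' where j': "j' = ((P', Q'), v')" by (metis surj_pair)
  have "P < N" "P' < N" "v < s" "v' < s" using assms R_sub by (auto simp: j j' positions_def)
  then show ?thesis using assms(3,4) by (auto simp: j j' blob_edge_eq shift_inj2)
qed

lemma finite_positions [simp]: "finite positions"
  using finite_subset[OF R_sub] by (simp add: positions_def)

lemma card_positions: "card positions = card R * s"
  by (simp add: positions_def card_cartesian_product)

definition coordinates :: "coordinate set" where
  "coordinates = (\<lambda>(\<beta>, v). Left_Type \<beta> v) ` positions \<union> (\<lambda>(\<beta>, c). Right_Type \<beta> c) ` positions \<union>
     (\<lambda>(b, i, \<beta>, v). Coin b i \<beta> v) ` (UNIV \<times> {..<s} \<times> positions)"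

lemma finite_coordinates [simp]: "finite coordinates"
  by (simp add: coordinates_def)

fun player_view :: "nat \<Rightarrow> (coordinate \<Rightarrow> bool) \<Rightarrow> (nat \<times> nat) \<times> nat \<Rightarrow> bool \<times> bool \<times> bool \<times> bool" where
  "player_view i \<omega> (\<beta>, v) = 
    (\<omega> (Left_Type \<beta> v), \<omega> (Right_Type \<beta> (shift i v)), \<omega> (Coin True i \<beta> v), \<omega> (Coin False i \<beta> v))"

definition hard_input :: "(coordinate \<Rightarrow> bool) \<Rightarrow> nat \<Rightarrow> nat set set" where
  "hard_input \<omega> i = edge i ` {j \<in> positions. base_x (player_view i \<omega> j)}"

text \<open>The matching of player \<open>i\<close> is perfect, so types indexed by its edges
  describe all types. The coins are kept.\<close>

definition set_types :: "nat \<Rightarrow> ((nat \<times> nat) \<times> nat \<Rightarrow> bool \<times> bool) \<Rightarrow> (coordinate \<Rightarrow> bool) \<Rightarrow> coordinate \<Rightarrow> bool" where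
  "set_types i y \<omega> k = (case k of 
      Left_Type \<beta> v \<Rightarrow> fst (y (\<beta>, v))
    | Right_Type \<beta> c \<Rightarrow> snd (y (\<beta>, unshift i c))
    | Coin b i' \<beta> v \<Rightarrow> \<omega> k)"

text \<open>The two-party view: player \<open>i\<close> holds \<open>x\<close>, and everybody else
  together holds the types \<open>y\<close> and the coins in \<open>\<omega>\<close>.\<close>

definition mixed_input :: "nat \<Rightarrow> ((nat \<times> nat) \<times> nat \<Rightarrow> bool) \<Rightarrow> ((nat \<times> nat) \<times> nat \<Rightarrow> bool \<times> bool)
    \<Rightarrow> (coordinate \<Rightarrow> bool) \<Rightarrow> nat \<Rightarrow> nat set set" where
  "mixed_input i x y \<omega> = (hard_input (set_types i y \<omega>))(i := edge i ` {j \<in> positions. x j})"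

text \<open>Overwrites the four bits that \<open>player_view i\<close> reads at each position of
  \<open>J\<close>. The test \<open>c < s\<close> is there because \<open>unshift\<close> maps every
  number into the range.\<close>

definition set_view :: "nat \<Rightarrow> ((nat \<times> nat) \<times> nat) set \<Rightarrow> ((nat \<times> nat) \<times> nat \<Rightarrow> bool \<times> bool \<times> bool \<times> bool)
    \<Rightarrow> (coordinate \<Rightarrow> bool) \<Rightarrow> coordinate \<Rightarrow> bool" where
  "set_view i J z \<omega> k = (case k of
      Left_Type \<beta> v \<Rightarrow> if (\<beta>, v) \<in> J then fst (z (\<beta>, v)) else \<omega> k
    | Right_Type \<beta> c \<Rightarrow> if c < s \<and> (\<beta>, unshift i c) \<in> J then fst (snd (z (\<beta>, unshift i c))) else \<omega> k
    | Coin b i' \<beta> v \<Rightarrow> if i' = i \<and> (\<beta>, v) \<in> J 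
        then (if b then fst (snd (snd (z (\<beta>, v)))) else snd (snd (snd (z (\<beta>, v))))) else \<omega> k)"

text \<open>Different positions of one player read disjoint sets of four bits, since its edges form
  matchings. Hence the view of player \<open>i\<close> can be redrawn independently of the rest; the
  induction resamples four coordinates at a time.\<close>

lemma avg_set_view:
  assumes "i < s" "J \<subseteq> positions"
  shows "avg coordinates F = avg coordinates (\<lambda>\<omega>. avg J (\<lambda>z. F (set_view i J z \<omega>)))"
  using finite_subset[OF assms(2) finite_positions] assms(2)
proof (induction J arbitrary: F)
  case empty
  have "set_view i {} z \<omega> = \<omega>" for z \<omega>
  proof
    show "set_view i {} z \<omega> k = \<omega> k" for k by (cases k) (simp_all add: set_view_def)
  qed
  then show ?case by simp
next
  case (insert j J)
  obtain \<beta> v where j: "j = (\<beta>, v)" by (cases j)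
  have v: "v < s" "(\<beta>, v) \<in> positions" using insert.prems by (auto simp: j positions_def)
  define k1 k2 k3 k4 where "k1 = Left_Type \<beta> v" and "k2 = Right_Type \<beta> (shift i v)" 
    and "k3 = Coin True i \<beta> v" and "k4 = Coin False i \<beta> v"
  have k: "k1 \<in> coordinates" "k2 \<in> coordinates" "k3 \<in> coordinates" "k4 \<in> coordinates"
    using v assms(1) by (auto simp: k1_def k2_def k3_def k4_def coordinates_def image_iff positions_def)
  have upd: "set_view i (insert j J) (z(j := (a1, a2, a3, a4))) \<omega> = 
      (set_view i J z \<omega>)(k1 := a1, k2 := a2, k3 := a3, k4 := a4)" for z \<omega> a1 a2 a3 a4
  proof
    fix k
    show "set_view i (insert j J) (z(j := (a1, a2, a3, a4))) \<omega> k = 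
      ((set_view i J z \<omega>)(k1 := a1, k2 := a2, k3 := a3, k4 := a4)) k"
    proof (cases k)
      case (Right_Type \<beta>' c)
      have "c < s \<and> unshift i c = v \<longleftrightarrow> c = shift i v"
        using assms(1) v(1) by (metis shift_less(1) shift_unshift unshift_shift)
      then show ?thesis using Right_Type by (auto simp: set_view_def k1_def k2_def k3_def k4_def j)
    qed (auto simp: set_view_def k1_def k2_def k3_def k4_def j)
  qed
  define F' where "F' \<omega> = (\<Sum>a1\<in>UNIV. \<Sum>a2\<in>UNIV. \<Sum>a3\<in>UNIV. \<Sum>a4\<in>UNIV. 
      F ((\<omega>)(k1 := a1, k2 := a2, k3 := a3, k4 := a4))) / 16" for \<omega>
  have "avg coordinates F = avg coordinates F'"
    unfolding F'_def
    by (subst avg_resample_inside[OF finite_coordinates k(4)], subst avg_resample_inside[OF finite_coordinates k(3)],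
        subst avg_resample_inside[OF finite_coordinates k(2)], subst avg_resample_inside[OF finite_coordinates k(1)])
       (simp add: sum_divide_distrib[symmetric])
  also have "\<dots> = avg coordinates (\<lambda>\<omega>. avg J (\<lambda>z. F' (set_view i J z \<omega>)))"
    using insert by blast
  also have "\<dots> = avg coordinates (\<lambda>\<omega>. avg (insert j J) (\<lambda>z. F (set_view i (insert j J) z \<omega>)))"
    unfolding F'_def avg_insert[OF insert.hyps] sum_UNIV_prod upd avg_divide avg_sum
    by simp
  finally show ?case .
qed

lemma set_view_player_view: 
  assumes "i < s" "j \<in> positions"
  shows "player_view i (set_view i positions z \<omega>) j = z j"
  using assms by (cases j) (auto simp: set_view_def positions_def)

text \<open>Only types and coins of player \<open>i\<close> are changed by \<open>set_view\<close>,
  and \<open>mixed_input\<close> replaces the types by \<open>y\<close> and the edges of player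
  \<open>i\<close> by \<open>x\<close>.\<close>

lemma mixed_input_set_view:
  assumes "i < s"
  shows "mixed_input i x y (set_view i positions z \<omega>) = mixed_input i x y \<omega>"
proof -
  have "base_x (player_view k (set_types i y (set_view i positions z \<omega>)) j) 
      \<longleftrightarrow> base_x (player_view k (set_types i y \<omega>) j)" if "k \<noteq> i" for k j
    using that by (cases j) (auto simp: set_view_def set_types_def)
  then show ?thesis
    by (auto simp: mixed_input_def hard_input_def fun_eq_iff)
qed

text \<open>Once the view \<open>z\<close> is fixed, the remaining randomness is in the coins of the
  other players. So it can serve as private randomness of the second party, independent of
  \<open>x\<close> and \<open>y\<close>.\<close>

lemma hard_input_set_view:
  assumes "i < s"
  shows "hard_input (set_view i positions z \<omega>) 
    = mixed_input i (\<lambda>j\<in>positions. base_x (z j)) (\<lambda>j\<in>positions. base_y (z j)) \<omega>"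
proof
  fix k
  have by_eq: "base_y w = (fst w, fst (snd w))" for w by (cases w) auto
  show "hard_input (set_view i positions z \<omega>) k 
    = mixed_input i (\<lambda>j\<in>positions. base_x (z j)) (\<lambda>j\<in>positions. base_y (z j)) \<omega> k"
  proof (cases "k = i")
    case True
    have "{j \<in> positions. base_x (player_view i (set_view i positions z \<omega>) j)} = 
        {j \<in> positions. (\<lambda>j\<in>positions. base_x (z j)) j}"
      using assms by (auto simp only: set_view_player_view restrict_apply')
    then show ?thesis using True by (simp add: hard_input_def mixed_input_def)
  next
    case False
    have "base_x (player_view k (set_view i positions z \<omega>) j) 
      \<longleftrightarrow> base_x (player_view k (set_types i (\<lambda>j\<in>positions. base_y (z j)) \<omega>) j)" if "j \<in> positions" for j
      using that False by (cases j) (auto simp: set_view_def set_types_def by_eq positions_def)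
    then have "{j \<in> positions. base_x (player_view k (set_view i positions z \<omega>) j)} = 
        {j \<in> positions. base_x (player_view k (set_types i (\<lambda>j\<in>positions. base_y (z j)) \<omega>) j)}"
      by blast
    then show ?thesis using False by (simp add: hard_input_def mixed_input_def)
  qed
qed

lemma mixed_input_sub: "mixed_input i x y \<omega> k \<subseteq> edge k ` positions"
  by (auto simp: mixed_input_def hard_input_def)

lemma edge_in_all_edges:
  assumes "j \<in> positions" "2 * N * s \<le> n"
  shows "edge i j \<in> all_edges n"
proof -
  obtain P Q v where j: "j = ((P, Q), v)" by (metis surj_pair)
  have v: "P < N" "Q < N" "v < s" using assms(1) R_sub by (auto simp: j positions_def)
  have "left_vertex P v < right_vertex Q (shift i v)" "right_vertex Q (shift i v) < n"
    using left_neq_right[OF v(1,3)] right_vertex_less[OF v(2) shift_less(1)[of i v]] assms(2) by (auto intro: order.strict_trans2)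
  then show ?thesis unfolding all_edges_def j by fastforce
qed

lemma mixed_input_no_dup:
  assumes "2 * N * s \<le> n"
  shows "no_dup_input s n (mixed_input i x y \<omega>)"
proof -
  have "mixed_input i x y \<omega> k \<inter> mixed_input i x y \<omega> k' = {}" if "k < s" "k' < s" "k \<noteq> k'" for k k'
  proof -
    have "edge k ` positions \<inter> edge k' ` positions = {}"
      using that edge_eq by blast
    then show ?thesis using mixed_input_sub[of i x y \<omega> k] mixed_input_sub[of i x y \<omega> k'] by blast
  qed
  then show ?thesis
    unfolding no_dup_input_def disjoint_family_on_def
    using mixed_input_sub[of i x y \<omega>] edge_in_all_edges[OF _ assms] by blast
qed

lemma mixed_input_graph: "input_graph s (mixed_input i x y \<omega>) \<subseteq> all_blobs"
proof -
  have "edge k j \<in> all_blobs" if "j \<in> positions" for k j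
  proof -
    obtain P Q v where "j = ((P, Q), v)" by (metis surj_pair)
    then show ?thesis using that unfolding all_blobs_def positions_def by fastforce
  qed
  then show ?thesis using mixed_input_sub[of i x y \<omega>] by (force simp: input_graph_def)
qed

lemma edge_in_mixed_input:
  assumes "edge k j \<in> input_graph s (mixed_input i x y \<omega>)" "j \<in> positions" "k < s" "i < s"
  shows "k = i \<and> x j \<or> k \<noteq> i \<and> base_x (player_view k (set_types i y \<omega>) j)"
proof -
  obtain k' where k': "k' < s" "edge k j \<in> mixed_input i x y \<omega> k'"
    using assms(1) by (auto simp: input_graph_def)
  then obtain j' where "j' \<in> positions" "edge k j = edge k' j'"
    using mixed_input_sub[of i x y \<omega> k'] by auto
  then have "k' = k" using edge_eq[OF assms(2) _ assms(3) k'(1)] by auto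
  then show ?thesis using k'(2) edge_eq[OF assms(2) _ assms(3) assms(3)]
    by (auto simp: mixed_input_def hard_input_def split: if_splits)
qed

text \<open>The planted edge is isolated in its blob. Another edge of player \<open>i\<close> there
  belongs to the same matching and is disjoint from it; an edge of another player needs both types
  \<open>True\<close>, but the ends of the planted edge have type \<open>False\<close>.\<close>

lemma planted_edge_in_spanner:
  assumes n: "2 * N * s \<le> n" and "i < s" "j \<in> positions" "x j" "y j = (False, False)"
    and sp: "is_spanner 3 n (input_graph s (mixed_input i x y \<omega>)) H"
  shows "edge i j \<in> H"
proof -
  obtain P Q v where j: "j = ((P, Q), v)" by (metis surj_pair)
  have PQ: "(P, Q) \<in> R" "v < s" using assms(3) by (auto simp: j positions_def)
  have pos: "((P, Q), w) \<in> positions \<longleftrightarrow> w < s" for w using PQ by (auto simp: positions_def)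
  have e: "edge i j \<in> input_graph s (mixed_input i x y \<omega>)"
    using assms by (auto simp: input_graph_def mixed_input_def intro!: bexI[of _ i])
  have key: "w = v \<and> c = shift i v" 
    if "{left_vertex P w, right_vertex Q c} \<in> input_graph s (mixed_input i x y \<omega>)" 
       "w < s" "c < s" "w = v \<or> c = shift i v" for w c
  proof -
    \<comment> \<open>The player whose matching joins \<open>w\<close> to \<open>c\<close>, namely
      \<open>c - w\<close> modulo \<open>s\<close>.\<close>
    define k where "k = (if w \<le> c then c - w else c + s - w)"
    have k: "k < s" "shift k w = c" using that(2,3) by (auto simp: k_def shift_eq)
    have "edge k ((P, Q), w) \<in> input_graph s (mixed_input i x y \<omega>)" using that k by simp
    from edge_in_mixed_input[OF this _ k(1) \<open>i < s\<close>] 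
    have "k = i \<or> (k \<noteq> i \<and> base_x (player_view k (set_types i y \<omega>) ((P, Q), w)))"
      using that pos by auto
    then show ?thesis
    proof
      assume "k = i"
      then show ?thesis using that(4) k(2) shift_inj[OF that(2) PQ(2) \<open>i < s\<close>] by auto
    next
      assume "k \<noteq> i \<and> base_x (player_view k (set_types i y \<omega>) ((P, Q), w))"
      then have "fst (y ((P, Q), w)) \<and> snd (y ((P, Q), unshift i c))"
        using k(2) by (auto simp: set_types_def)
      then show ?thesis using that(4) assms(5) PQ(2) \<open>i < s\<close> by (auto simp: j)
    qed
  qed
  have "{left_vertex P v, right_vertex Q (shift i v)} \<in> H"
    by (rule isolated_edge_in_spanner[OF sp n mixed_input_graph PQ shift_less(1)])
       (use e key PQ in \<open>auto simp: j\<close>)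
  then show ?thesis by (simp add: j)
qed

lemma unplanted_edge_not_in_spanner:
  assumes "i < s" "j \<in> positions" "\<not> x j" 
    and sp: "is_spanner 3 n (input_graph s (mixed_input i x y \<omega>)) H"
  shows "edge i j \<notin> H"
  using edge_in_mixed_input[of i j i x y \<omega>] assms by (auto simp: is_spanner_def)

section \<open>From the advantage at planted edges to the length of the channels\<close>

definition view_x :: "nat \<Rightarrow> (coordinate \<Rightarrow> bool) \<Rightarrow> (nat \<times> nat) \<times> nat \<Rightarrow> bool" where
  "view_x i \<omega> = (\<lambda>j\<in>positions. base_x (player_view i \<omega> j))"

definition view_y :: "nat \<Rightarrow> (coordinate \<Rightarrow> bool) \<Rightarrow> (nat \<times> nat) \<times> nat \<Rightarrow> bool \<times> bool" where
  "view_y i \<omega> = (\<lambda>j\<in>positions. base_y (player_view i \<omega> j))"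

text \<open>The types at the edge are set to \<open>(False, False)\<close> for both values of
  \<open>c\<close>, so that only player \<open>i\<close> can see whether the edge is
  planted.\<close>

definition planted_input :: "nat \<Rightarrow> (nat \<times> nat) \<times> nat \<Rightarrow> bool \<Rightarrow> (coordinate \<Rightarrow> bool) \<Rightarrow> nat \<Rightarrow> nat set set" where
  "planted_input i j c \<omega> = mixed_input i ((view_x i \<omega>)(j := c)) ((view_y i \<omega>)(j := (False, False))) \<omega>"

definition advantage :: "protocol \<Rightarrow> nat \<Rightarrow> (nat \<times> nat) \<times> nat \<Rightarrow> (coordinate \<Rightarrow> bool) \<Rightarrow> real" where
  "advantage P i j \<omega> = of_bool (edge i j \<in> protocol_output s P (planted_input i j True \<omega>))
     - of_bool (edge i j \<in> protocol_output s P (planted_input i j False \<omega>))"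

lemma view_set_view:
  assumes "i < s"
  shows "view_x i (set_view i positions z \<omega>) = (\<lambda>j\<in>positions. base_x (z j))"
    and "view_y i (set_view i positions z \<omega>) = (\<lambda>j\<in>positions. base_y (z j))"
  unfolding view_x_def view_y_def by (auto intro!: restrict_ext simp only: set_view_player_view[OF assms])

text \<open>Instance of \<open>two_party\<close> in which the transcript is the content of channel
  \<open>i\<close> alone, although the other players and the coordinator exchange many more bits
  among themselves.\<close>

lemma player_advantage:
  assumes i: "i < s"
    and bounded: "\<And>x y \<omega> h. run s P (mixed_input i x y \<omega>) h \<Longrightarrow> length h \<le> T"
  shows "(\<Sum>j\<in>positions. avg coordinates (advantage P i j)) \<le> 
    1152 * avg coordinates (\<lambda>\<omega>. real (length (channel i (final_history s P (hard_input \<omega>)))) * ln 8 + ln 2)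
    + real (card positions) / 6"
proof -
  define fh where "fh x y \<omega> = final_history s P (mixed_input i x y \<omega>)" for x y \<omega>
  define ch where "ch x y \<omega> = channel i (fh x y \<omega>)" for x y \<omega>
  define out where "out j x y \<omega> \<longleftrightarrow> edge i j \<in> protocol_output s P (mixed_input i x y \<omega>)" for j x y \<omega>
  have fin: "final s P (mixed_input i x y \<omega>) (fh x y \<omega>)" for x y \<omega>
    unfolding fh_def using bounded by (rule final_final_history)
  \<comment> \<open>Given the channel content, the whole history, and with it the output, is
    determined by \<open>y\<close> and \<open>\<omega>\<close>. Hence the event \<open>Q\<close>
    below concerns the second party only, and \<open>ch x y \<omega> = l\<close> splits into
    conditions on the two parties.\<close>
  have rect: "fh x y \<omega> = fh x' y \<omega>" if "ch x y' \<omega>' = ch x' y \<omega>" for x y \<omega> x' y' \<omega>'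
  proof -
    have "(mixed_input i x' y \<omega>)(i := mixed_input i x y' \<omega>' i) = mixed_input i x y \<omega>"
      by (simp add: mixed_input_def)
    then have "final s P (mixed_input i x y \<omega>) (fh x' y \<omega>)"
      using final_rectangle[OF fin fin, of i x' y \<omega> x y' \<omega>'] that by (simp add: ch_def)
    then show ?thesis using fin final_unique by blast
  qed
  define L where "L = {l :: message list. length l \<le> T}"
  have chL: "ch x y \<omega> \<in> L" for x y \<omega>
  proof -
    have "length (fh x y \<omega>) \<le> T" using bounded[of x y \<omega>] fin[of x y \<omega>] by (simp add: final_def)
    moreover have "length (ch x y \<omega>) \<le> length (fh x y \<omega>)"
      unfolding ch_def channel_def by simp
    ultimately show ?thesis by (simp add: L_def)
  qed
  define A where "A l x \<longleftrightarrow> (\<exists>y \<omega>. ch x y \<omega> = l)" for l x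
  define B where "B l y \<omega> \<longleftrightarrow> (\<exists>x. ch x y \<omega> = l)" for l y \<omega>
  define Q where "Q l j y \<omega> \<longleftrightarrow> (\<exists>x. ch x y \<omega> = l \<and> out j x y \<omega>)" for l j y \<omega>
  have AB: "A l x \<and> B l y \<omega> \<longleftrightarrow> ch x y \<omega> = l" for l x y \<omega>
    unfolding A_def B_def using rect unfolding ch_def by metis
  have AQ: "A l x \<and> Q l j y \<omega> \<longleftrightarrow> ch x y \<omega> = l \<and> out j x y \<omega>" for l x j y \<omega>
    unfolding A_def Q_def using rect unfolding ch_def out_def protocol_output_def fh_def by metis
  define a where "a l x = (of_bool (A l x) :: real)" for l x
  define b where "b l y = avg coordinates (\<lambda>\<omega>. of_bool (B l y \<omega>))" for l y
  define q where "q l j y = avg coordinates (\<lambda>\<omega>. of_bool (Q l j y \<omega>))" for l j y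
  define W where "W l = (1 / 8 :: real) ^ length l / 2" for l :: "message list"
  have ab: "(\<Sum>l\<in>L. a l x * b l y * w l) = avg coordinates (\<lambda>\<omega>. w (ch x y \<omega>))" for x y w
  proof -
    have "(\<Sum>l\<in>L. a l x * b l y * w l) = avg coordinates (\<lambda>\<omega>. \<Sum>l\<in>L. of_bool (A l x \<and> B l y \<omega>) * w l)"
      by (simp add: a_def b_def avg_sum avg_cmult avg_multc of_bool_conj)
    also have "\<dots> = avg coordinates (\<lambda>\<omega>. \<Sum>l\<in>L. if ch x y \<omega> = l then w l else 0)"
      unfolding AB by (intro avg_cong sum.cong) auto
    also have "\<dots> = avg coordinates (\<lambda>\<omega>. w (ch x y \<omega>))"
      using chL by (simp add: L_def finite_message_lists)
    finally show ?thesis .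
  qed
  have aq: "(\<Sum>l\<in>L. a l x * q l j y) = avg coordinates (\<lambda>\<omega>. of_bool (out j x y \<omega>))" for x j y
  proof -
    have "(\<Sum>l\<in>L. a l x * q l j y) = avg coordinates (\<lambda>\<omega>. \<Sum>l\<in>L. of_bool (A l x \<and> Q l j y \<omega>))"
      by (simp add: a_def q_def avg_sum avg_cmult of_bool_conj)
    also have "\<dots> = avg coordinates (\<lambda>\<omega>. \<Sum>l\<in>L. if ch x y \<omega> = l then of_bool (out j x y \<omega>) else 0)"
      unfolding AQ by (intro avg_cong sum.cong) auto
    also have "\<dots> = avg coordinates (\<lambda>\<omega>. of_bool (out j x y \<omega>))"
      using chL by (simp add: L_def finite_message_lists)
    finally show ?thesis .
  qed
  have QB: "Q l j y \<omega> \<Longrightarrow> B l y \<omega>" for l j y \<omega>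
    unfolding Q_def B_def by blast
  define X where "X z = (\<lambda>j\<in>positions. base_x (z j))" for z
  define Y where "Y z = (\<lambda>j\<in>positions. base_y (z j))" for z
  have main: "(\<Sum>j\<in>positions. avg positions (\<lambda>z. \<Sum>l\<in>L. (a l ((X z)(j := True)) - a l ((X z)(j := False))) * 
      q l j ((Y z)(j := (False, False)))))
    \<le> 1152 * avg positions (\<lambda>z. \<Sum>l\<in>L. a l (X z) * b l (Y z) * ln (1 / W l)) + card positions / 6"
    unfolding X_def Y_def
  proof (rule two_party)
    show "0 \<le> a l x" "a l x \<le> 1" for l x by (auto simp: a_def)
    show "0 \<le> b l y" for l y unfolding b_def by (intro avg_nonneg) auto
    have "b l y \<le> avg coordinates (\<lambda>_ :: coordinate \<Rightarrow> bool. 1)" for l y 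
      unfolding b_def by (intro avg_mono) auto
    then show "b l y \<le> 1" for l y by simp
    show "0 \<le> q l j y" for l j y unfolding q_def by (intro avg_nonneg) auto
    show "q l j y \<le> b l y" for l j y unfolding q_def b_def by (intro avg_mono) (auto dest: QB)
    show "(\<Sum>l\<in>L. a l x * b l y) = 1" for x y
      using ab[of x y "\<lambda>_. 1"] by simp
    show "0 < W l" for l by (simp add: W_def)
    show "sum W L \<le> 1" unfolding W_def L_def by (rule message_list_weights)
  qed (auto simp: L_def finite_message_lists)
  have lnW: "ln (1 / W l) = real (length l) * ln 8 + ln 2" for l
    by (simp add: W_def power_divide ln_mult ln_realpow)
  have "avg positions (\<lambda>z. \<Sum>l\<in>L. a l (X z) * b l (Y z) * ln (1 / W l))
      = avg coordinates (\<lambda>\<omega>. avg positions (\<lambda>z. real (length (ch (X z) (Y z) \<omega>)) * ln 8 + ln 2))"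
    unfolding ab lnW by (rule avg_swap)
  also have "\<dots> = avg coordinates (\<lambda>\<omega>. real (length (channel i (final_history s P (hard_input \<omega>)))) * ln 8 + ln 2)"
    \<comment> \<open>An independent pair of \<open>\<omega>\<close> and a view \<open>z\<close>
      amounts to one sample of the hard distribution.\<close>
    by (subst (2) avg_set_view[OF i order.refl])
       (simp add: hard_input_set_view[OF i] ch_def fh_def X_def Y_def)
  finally have rhs: "avg positions (\<lambda>z. \<Sum>l\<in>L. a l (X z) * b l (Y z) * ln (1 / W l)) = \<dots>" .
  have "avg positions (\<lambda>z. \<Sum>l\<in>L. (a l ((X z)(j := True)) - a l ((X z)(j := False))) * 
      q l j ((Y z)(j := (False, False)))) = avg coordinates (advantage P i j)" for j
  proof -
    have "avg positions (\<lambda>z. \<Sum>l\<in>L. (a l ((X z)(j := True)) - a l ((X z)(j := False))) * 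
        q l j ((Y z)(j := (False, False)))) 
      = avg positions (\<lambda>z. avg coordinates (\<lambda>\<omega>. of_bool (out j ((X z)(j := True)) ((Y z)(j := (False, False))) \<omega>)
        - of_bool (out j ((X z)(j := False)) ((Y z)(j := (False, False))) \<omega>)))"
      by (simp add: left_diff_distrib sum_subtractf aq avg_diff)
    also have "\<dots> = avg coordinates (\<lambda>\<omega>. avg positions (\<lambda>z. of_bool (out j ((X z)(j := True)) ((Y z)(j := (False, False))) \<omega>)
        - of_bool (out j ((X z)(j := False)) ((Y z)(j := (False, False))) \<omega>)))"
      by (rule avg_swap)
    also have "\<dots> = avg coordinates (advantage P i j)"
      by (subst (2) avg_set_view[OF i order.refl])
         (simp add: advantage_def planted_input_def view_set_view[OF i] mixed_input_set_view[OF i] 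
            X_def Y_def out_def)
    finally show ?thesis .
  qed
  then show ?thesis using main unfolding rhs by simp
qed

text \<open>The unplanted distribution is the same for every player, so the bounds for all players
  refer to the same runs, and the channel lengths add up to at most the length of the
  history.\<close>

lemma total_advantage:
  assumes n: "2 * N * s \<le> n"
    and bounded: "\<And>E h. no_dup_input s n E \<Longrightarrow> run s P E h \<Longrightarrow> length h \<le> T"
  shows "(\<Sum>i<s. \<Sum>j\<in>positions. avg coordinates (advantage P i j)) \<le> 
    1152 * (3 * real T + real s) + real s * real (card positions) / 6"
proof -
  have len: "real (\<Sum>i<s. length (channel i (final_history s P (hard_input \<omega>)))) \<le> real T" for \<omega>
  proof -
    \<comment> \<open>Presents the hard input as a mixed input, from which it inherits the absence
      of duplication. Player 0 exists because \<open>s\<close> is positive.\<close>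
    have "hard_input \<omega> = mixed_input 0 (view_x 0 \<omega>) (view_y 0 \<omega>) \<omega>"
    proof -
      have "set_view 0 positions (player_view 0 \<omega>) \<omega> = \<omega>"
      proof
        show "set_view 0 positions (player_view 0 \<omega>) \<omega> k = \<omega> k" for k
          by (cases k) (auto simp: set_view_def s_pos)
      qed
      then show ?thesis
        using hard_input_set_view[OF s_pos, of "player_view 0 \<omega>" \<omega>] by (simp add: view_x_def view_y_def)
    qed
    then have "no_dup_input s n (hard_input \<omega>)" using mixed_input_no_dup[OF n] by simp
    then have "length (final_history s P (hard_input \<omega>)) \<le> T"
      using bounded final_final_history[of s P "hard_input \<omega>" T] by (auto simp: final_def)
    then show ?thesis using sum_length_channel[of "final_history s P (hard_input \<omega>)" s] by linarith
  qed
  have ln8: "ln (8 :: real) \<le> 3"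
  proof -
    have "ln ((2 :: real) ^ 3) = 3 * ln 2" by (subst ln_realpow) auto
    then show ?thesis using ln_2_less_1 by simp
  qed
  have "(\<Sum>i<s. \<Sum>j\<in>positions. avg coordinates (advantage P i j)) \<le> 
    (\<Sum>i<s. 1152 * avg coordinates (\<lambda>\<omega>. real (length (channel i (final_history s P (hard_input \<omega>)))) * ln 8 + ln 2)
    + real (card positions) / 6)"
    by (intro sum_mono player_advantage) (auto intro: bounded mixed_input_no_dup[OF n])
  also have "\<dots> = 1152 * avg coordinates (\<lambda>\<omega>. real (\<Sum>i<s. length (channel i (final_history s P (hard_input \<omega>)))) * ln 8 + real s * ln 2)
    + real s * real (card positions) / 6"
    by (simp add: sum.distrib sum_distrib_left[symmetric] sum_distrib_right avg_sum[symmetric])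
  also have "avg coordinates (\<lambda>\<omega>. real (\<Sum>i<s. length (channel i (final_history s P (hard_input \<omega>)))) * ln 8 + real s * ln 2)
      \<le> avg coordinates (\<lambda>_ :: coordinate \<Rightarrow> bool. real T * 3 + real s * 1)"
    by (intro avg_mono add_mono mult_mono len ln8) (use ln_2_less_1 in auto)
  also have "\<dots> = 3 * real T + real s" by simp
  finally show ?thesis by simp
qed

text \<open>Success with probability 2/3 on both planted inputs forces an expected advantage of 2/3
  + 2/3 - 1 = 1/3 for each player and position. Of this, 1/6 remains after the error term of
  \<open>total_advantage\<close>.\<close>

lemma randomized_bound:
  assumes n: "2 * N * s \<le> n" and comp: "computes_spanner 3 s n \<pi>"
    and bounded: "\<And>P E h. P \<in> set_pmf \<pi> \<Longrightarrow> no_dup_input s n E \<Longrightarrow> run s P E h \<Longrightarrow> length h \<le> T"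
  shows "real s * (real (card R) * real s) / 6 \<le> 1152 * (3 * real T + real s)"
proof -
  let ?S = "\<lambda>P. \<Sum>i<s. \<Sum>j\<in>positions. avg coordinates (advantage P i j)"
  have meas: "integrable (measure_pmf \<pi>) (\<lambda>P. f P)" if "\<And>P. \<bar>f P\<bar> \<le> 1" for f :: "protocol \<Rightarrow> real"
    by (rule measure_pmf.integrable_const_bound[where B = 1]) (use that in auto)
  have adv1: "\<bar>advantage P i j \<omega>\<bar> \<le> 1" for P i j \<omega>
    by (simp add: advantage_def of_bool_def)
  have point: "1 / 3 \<le> measure_pmf.expectation \<pi> (\<lambda>P. advantage P i j \<omega>)" 
    if "i < s" "j \<in> positions" for i j \<omega>
  proof -
    define good where "good c = {P. \<exists>H. outputs s P (planted_input i j c \<omega>) H \<and> 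
        is_spanner 3 n (input_graph s (planted_input i j c \<omega>)) H}" for c
    have prob: "2 / 3 \<le> measure_pmf.prob \<pi> (good c)" for c
      using comp mixed_input_no_dup[OF n] unfolding computes_spanner_def good_def planted_input_def by blast
    \<comment> \<open>If both runs succeed the advantage is 1, if one succeeds it is at least 0, and
      it is never below -1.\<close>
    have "indicator (good True) P - (1 - indicator (good False) P) \<le> advantage P i j \<omega>" for P
    proof -
      have "edge i j \<in> protocol_output s P (planted_input i j True \<omega>)" if P: "P \<in> good True"
      proof -
        obtain H where H: "outputs s P (planted_input i j True \<omega>) H"
          "is_spanner 3 n (input_graph s (planted_input i j True \<omega>)) H"
          using P by (auto simp: good_def)
        then show ?thesis
          using planted_edge_in_spanner[OF n \<open>i < s\<close> \<open>j \<in> positions\<close>, of "(view_x i \<omega>)(j := True)" 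
              "(view_y i \<omega>)(j := (False, False))" \<omega> H] outputs_protocol_output[OF H(1)]
          by (simp add: planted_input_def)
      qed
      moreover have "edge i j \<notin> protocol_output s P (planted_input i j False \<omega>)" if P: "P \<in> good False"
      proof -
        obtain H where H: "outputs s P (planted_input i j False \<omega>) H"
          "is_spanner 3 n (input_graph s (planted_input i j False \<omega>)) H"
          using P by (auto simp: good_def)
        then show ?thesis
          using unplanted_edge_not_in_spanner[OF \<open>i < s\<close> \<open>j \<in> positions\<close>, of "(view_x i \<omega>)(j := False)" n 
              "(view_y i \<omega>)(j := (False, False))" \<omega> H] outputs_protocol_output[OF H(1)]
          by (simp add: planted_input_def)
      qed
      ultimately show ?thesis by (auto simp: advantage_def indicator_def)
    qed
    then have "measure_pmf.expectation \<pi> (\<lambda>P. indicator (good True) P - (1 - indicator (good False) P))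
      \<le> measure_pmf.expectation \<pi> (\<lambda>P. advantage P i j \<omega>)"
      by (intro integral_mono meas) (auto simp: adv1 indicator_def)
    moreover have "measure_pmf.expectation \<pi> (\<lambda>P. indicator (good True) P - (1 - indicator (good False) P))
      = measure_pmf.prob \<pi> (good True) - (1 - measure_pmf.prob \<pi> (good False))"
    proof -
      have "integrable (measure_pmf \<pi>) (indicator (good c) :: protocol \<Rightarrow> real)" for c
        by (rule meas) (simp add: indicator_def)
      then show ?thesis by (simp add: Bochner_Integration.integral_diff)
    qed
    ultimately show ?thesis using prob[of True] prob[of False] by linarith
  qed
  have "real s * real (card positions) / 3 = (\<Sum>i<s. \<Sum>j\<in>positions. avg coordinates (\<lambda>_ :: coordinate \<Rightarrow> bool. 1 / 3))"
    by simp
  also have "\<dots> \<le> (\<Sum>i<s. \<Sum>j\<in>positions. avg coordinates (\<lambda>\<omega>. measure_pmf.expectation \<pi> (\<lambda>P. advantage P i j \<omega>)))"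
    by (intro sum_mono avg_mono point) auto
  also have "\<dots> = measure_pmf.expectation \<pi> ?S"
    unfolding avg_def
    by (subst Bochner_Integration.integral_sum) (auto intro!: Bochner_Integration.integrable_sum meas adv1 
        simp: Bochner_Integration.integral_sum meas adv1)
  also have "\<dots> \<le> measure_pmf.expectation \<pi> (\<lambda>_. 1152 * (3 * real T + real s) + real s * real (card positions) / 6)"
  proof (rule integral_mono_AE)
    show "integrable (measure_pmf \<pi>) ?S"
      unfolding avg_def
      by (intro Bochner_Integration.integrable_sum Bochner_Integration.integrable_divide meas adv1)
    show "AE P in measure_pmf \<pi>. ?S P \<le> 1152 * (3 * real T + real s) + real s * real (card positions) / 6"
      using total_advantage[OF n bounded] by (auto simp: AE_measure_pmf_iff)
  qed simp
  finally have "real s * real (card positions) / 6 \<le> 1152 * (3 * real T + real s)" by simp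
  then show ?thesis by (simp add: card_positions)
qed

end

section \<open>Primes and the incidence graph\<close>

lemma prod_primes_dvd:
  fixes A :: "nat set"
  assumes "finite A" "\<And>p. p \<in> A \<Longrightarrow> prime p" "\<And>p. p \<in> A \<Longrightarrow> p dvd n"
  shows "\<Prod>A dvd n"
  using assms
proof (induction A)
  case (insert p A)
  have "coprime p (\<Prod>A)"
    using insert by (intro prod_coprime_right primes_coprime) auto
  then show ?case using insert by (simp add: divides_mult)
qed simp

text \<open>For \<open>n = 2 * m + 1\<close> the primes between \<open>m + 2\<close> and
  \<open>n\<close> all divide \<open>n choose m\<close>. This coefficient occurs twice in a row of
  sum \<open>2 * 4 ^ m\<close>, so it is at most \<open>4 ^ m\<close>. Even \<open>n > 2\<close>
  contributes no prime.\<close>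

lemma primorial_le: "\<Prod>{p::nat. prime p \<and> p \<le> n} \<le> 4 ^ n"
proof (induction n rule: less_induct)
  case (less n)
  consider "n < 2" | "n = 2" | "n > 2" "even n" | m where "n = 2 * m + 1" "m \<ge> 1"
  proof -
    have "n < 2 \<or> n = 2 \<or> n > 2 \<and> even n \<or> (\<exists>m. n = 2 * m + 1 \<and> m \<ge> 1)" by presburger
    then show ?thesis using that by blast
  qed
  then show ?case
  proof cases
    case 1
    then have "{p::nat. prime p \<and> p \<le> n} = {}" by (auto dest: prime_ge_2_nat)
    then show ?thesis by (simp only: prod.empty) simp
  next
    case 2
    then have "{p::nat. prime p \<and> p \<le> n} = {2}" by (auto dest: prime_ge_2_nat)
    then have "\<Prod>{p::nat. prime p \<and> p \<le> n} = 2" by (simp only: prod.insert finite.emptyI) simp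
    then show ?thesis using 2 by simp
  next
    case 3
    then have "\<not> prime n" using prime_odd_nat by blast
    then have "{p::nat. prime p \<and> p \<le> n} = {p. prime p \<and> p \<le> n - 1}"
      using 3 by (metis (no_types, lifting) Suc_pred' le_Suc_eq not_less_iff_gr_or_eq less_nat_zero_code neq0_conv)
    then have "\<Prod>{p::nat. prime p \<and> p \<le> n} \<le> 4 ^ (n - 1)" using less.IH[of "n - 1"] 3 by simp
    also have "\<dots> \<le> 4 ^ n" by (intro power_increasing) auto
    finally show ?thesis .
  next
    case (4 m)
    let ?A = "{p::nat. prime p \<and> p \<le> m + 1}" and ?B = "{p::nat. prime p \<and> m + 1 < p \<and> p \<le> n}"
    have "{p::nat. prime p \<and> p \<le> n} = ?A \<union> ?B" using 4 by auto
    then have "\<Prod>{p::nat. prime p \<and> p \<le> n} = \<Prod>?A * \<Prod>?B"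
      using finite_subset[of ?A "{..n}"] finite_subset[of ?B "{..n}"] 4 by (subst prod.union_disjoint[symmetric]) auto
    also have "\<Prod>?A \<le> 4 ^ (m + 1)" using less.IH[of "m + 1"] 4 by simp
    also have "\<Prod>?B \<le> n choose m"
    proof (rule dvd_imp_le[OF prod_primes_dvd])
      fix p assume p: "p \<in> ?B"
      have "p dvd fact n" using p by (auto simp: prime_dvd_fact_iff)
      moreover have "fact m * fact (n - m) * (n choose m) = fact n"
        using 4 by (intro binomial_fact_lemma) auto
      moreover have "\<not> p dvd fact m" "\<not> p dvd fact (n - m)"
        using p 4 by (subst prime_dvd_fact_iff; auto)+
      ultimately show "p dvd n choose m"
        using p by (metis (no_types, lifting) mem_Collect_eq prime_dvd_mult_iff)
    qed (use 4 in auto)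
    also have "n choose m \<le> 4 ^ m"
    proof -
      have "(n choose m) + (n choose (m + 1)) = (\<Sum>k\<in>{m, m + 1}. n choose k)" by simp
      also have "\<dots> \<le> (\<Sum>k\<le>n. n choose k)" using 4 by (intro sum_mono2) auto
      also have "\<dots> = 2 * 4 ^ m" unfolding choose_row_sum using 4 by (simp add: power_mult)
      finally show ?thesis using 4 binomial_symmetric[of m n] by simp
    qed
    also have "(4 :: nat) ^ (m + 1) * 4 ^ m = 4 ^ n" unfolding 4 by (simp add: mult_2 power_add)
    finally show ?thesis by simp
  qed
qed

text \<open>Leibniz' harmonic triangle: the numbers \<open>1 / (k * (n choose k))\<close> are integer combinations of
  \<open>1, 1/2, \<dots>, 1/n\<close>.\<close>

lemma harmonic_triangle:
  assumes "\<And>j. 1 \<le> j \<Longrightarrow> j \<le> n \<Longrightarrow> j dvd L" "1 \<le> k" "k \<le> n"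
  shows "k * (n choose k) dvd L"
proof -
  have "real L / (real k * real (n choose k)) \<in> \<int>"
    using assms(2,3,1)
  proof (induction k arbitrary: n rule: nat_induct_at_least)
    case base
    then have "n dvd L" by auto
    then obtain c where "L = n * c" ..
    then have "real L / (real 1 * real (n choose 1)) = of_int (int c)" using base by simp
    then show ?case by (metis Ints_of_int)
  next
    case (Suc k)
    then obtain m where m: "n = Suc m" "k \<le> m" by (cases n) auto
    have "real L / (real k * real (m choose k)) \<in> \<int>" "real L / (real k * real (n choose k)) \<in> \<int>"
      using Suc m by (auto intro!: Suc.IH)
    moreover have "real L / (real (Suc k) * real (n choose Suc k)) 
        = real L / (real k * real (m choose k)) - real L / (real k * real (n choose k))"
    proof -
      define b where "b = real (m choose k)"
      have b: "b > 0" using m by (simp add: b_def)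
      have "Suc k * (Suc m choose Suc k) = Suc m * (m choose k)" by (rule Suc_times_binomial)
      then have e1: "real (Suc k) * real (n choose Suc k) = (real m + 1) * b"
        unfolding m(1) b_def by (metis add.commute of_nat_Suc of_nat_mult)
      have "(Suc m - k) * (Suc m choose k) = Suc m * (m choose k)"
        using binomial_absorb_comp[of "Suc m" k] by simp
      then have "real (Suc m - k) * real (n choose k) = (real m + 1) * b"
        unfolding m(1) b_def by (metis add.commute of_nat_Suc of_nat_mult)
      then have e2: "real (n choose k) = (real m + 1) * b / (real m + 1 - real k)"
        using m by (simp add: field_simps of_nat_diff)
      show ?thesis
      proof -
        define d where "d = real m + 1 - real k"
        have d: "d > 0" "real m + 1 = real k + d" and k: "real k > 0" using m Suc.hyps by (auto simp: d_def)
        show ?thesis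
          unfolding e1 e2 b_def[symmetric] d_def[symmetric] d(2) using b d(1) k
          by (simp add: divide_simps) (simp add: algebra_simps)
      qed
    qed
    ultimately show ?case by simp
  qed
  then obtain z :: int where z: "real L / (real k * real (n choose k)) = of_int z"
    by (elim Ints_cases)
  have "k * (n choose k) > 0" using assms by simp
  then have "real_of_int (int L) = real_of_int (int (k * (n choose k)) * z)"
    using z by (simp add: field_simps)
  then have "int L = int (k * (n choose k)) * z" by (simp only: of_int_eq_iff)
  then have "int (k * (n choose k)) dvd int L" by simp
  then show ?thesis by (simp only: int_dvd_int_iff)
qed

lemma prime_power_dvd_Lcm:
  fixes A :: "nat set"
  assumes "prime p" "finite A" "A \<noteq> {}" "0 \<notin> A" "p ^ a dvd Lcm A"
  shows "\<exists>x\<in>A. p ^ a dvd x"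
  using assms(2-5)
proof (induction rule: finite_ne_induct)
  case (insert x A)
  have nz: "x \<noteq> 0" "Lcm A \<noteq> 0" using insert by (auto simp: Lcm_0_iff)
  have "p ^ a dvd lcm x (Lcm A)" using insert by simp
  then have "a \<le> max (multiplicity p x) (multiplicity p (Lcm A))"
    using multiplicity_geI[of "lcm x (Lcm A)" p a] multiplicity_lcm[of x "Lcm A" p] nz assms(1) prime_gt_1_nat[of p]
    by (auto simp: lcm_eq_0_iff)
  then have "p ^ a dvd x \<or> p ^ a dvd Lcm A"
    by (auto simp: le_max_iff_disj intro: multiplicity_dvd')
  then show ?case using insert by auto
qed auto

text \<open>Takes the place of Legendre's formula: the binomial coefficient divides the least common
  multiple of 1 to \<open>n\<close>, and a prime power dividing that divides one of these
  numbers.\<close>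

lemma prime_power_dvd_binomial:
  assumes "prime p" "p ^ a dvd n choose k" "1 \<le> k" "k \<le> n"
  shows "p ^ a \<le> n"
proof -
  have "k * (n choose k) dvd Lcm {1..n}"
    using assms by (intro harmonic_triangle) auto
  then have "p ^ a dvd Lcm {1..n}" using assms(2) by (metis dvd_trans dvd_triv_right)
  then obtain x where "x \<in> {1..n}" "p ^ a dvd x"
    using prime_power_dvd_Lcm[OF assms(1), of "{1..n}" a] assms(3,4) by auto
  moreover from this have "p ^ a \<le> x" by (intro dvd_imp_le) auto
  ultimately show ?thesis by simp
qed

text \<open>Without primes in the gap all prime factors are at most \<open>n\<close>. Those with
  \<open>p\<^sup>2 \<le> 4 * n\<close> number at most \<open>sqrt (4 * n)\<close> and contribute a
  power of at most \<open>4 * n\<close> each; the others have multiplicity 1 and are bounded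
  together by \<open>primorial_le\<close>.\<close>

lemma central_binomial_le:
  assumes "1 \<le> n" and no_primes: "\<And>p. prime p \<Longrightarrow> n < p \<Longrightarrow> 4 * n < p"
  shows "real ((4 * n) choose (2 * n)) \<le> (4 * real n) powr sqrt (4 * real n) * 4 ^ n"
proof -
  define B where "B = (4 * n) choose (2 * n)"
  have B: "B \<noteq> 0" by (simp add: B_def)
  have le: "p ^ multiplicity p B \<le> 4 * n" if "prime p" for p
    using prime_power_dvd_binomial[OF that multiplicity_dvd[of p B, unfolded B_def]] assms(1) by (simp add: B_def)
  define S where "S = {p \<in> prime_factors B. p\<^sup>2 \<le> 4 * n}"
  define L where "L = {p \<in> prime_factors B. \<not> p\<^sup>2 \<le> 4 * n}"
  have SL: "prime_factors B = S \<union> L" "S \<inter> L = {}" "finite S" "finite L" by (auto simp: S_def L_def)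
  have pr: "prime p" "p \<le> n" if "p \<in> prime_factors B" for p
  proof -
    show p: "prime p" using that by auto
    have "multiplicity p B \<ge> 1" using that by (simp add: prime_factors_multiplicity)
    then have "p ^ 1 \<le> p ^ multiplicity p B" using p prime_gt_0_nat by (intro power_increasing) (auto simp: Suc_leI)
    then have "p \<le> 4 * n" using le[OF p] by simp
    then show "p \<le> n" using no_primes[OF p] by fastforce
  qed
  have "B = (\<Prod>p\<in>prime_factors B. p ^ multiplicity p B)"
    using prime_factorization_nat[of B] B by simp
  also have "\<dots> = (\<Prod>p\<in>S. p ^ multiplicity p B) * (\<Prod>p\<in>L. p ^ multiplicity p B)"
    using SL by (simp add: prod.union_disjoint)
  finally have eq: "B = \<dots>" .
  have "(\<Prod>p\<in>S. p ^ multiplicity p B) \<le> (\<Prod>p\<in>S. 4 * n)"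
    by (intro prod_mono) (use le pr in \<open>auto simp: S_def\<close>)
  then have 1: "(\<Prod>p\<in>S. p ^ multiplicity p B) \<le> (4 * n) ^ card S" by simp
  have "(\<Prod>p\<in>L. p ^ multiplicity p B) \<le> (\<Prod>p\<in>L. p)"
  proof (intro prod_mono conjI)
    fix p assume p: "p \<in> L"
    then have "prime p" using pr by (auto simp: L_def)
    have "multiplicity p B < 2"
    proof (rule ccontr)
      assume "\<not> multiplicity p B < 2"
      then have "p ^ 2 \<le> p ^ multiplicity p B" using \<open>prime p\<close> prime_gt_0_nat
        by (intro power_increasing) (auto simp: Suc_leI)
      then show False using le[OF \<open>prime p\<close>] p by (auto simp: L_def)
    qed
    then show "p ^ multiplicity p B \<le> p" using \<open>prime p\<close> prime_gt_0_nat[of p]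
      by (cases "multiplicity p B = 0") (auto simp: less_2_cases_iff)
  qed simp
  also have "\<dots> \<le> \<Prod>{p::nat. prime p \<and> p \<le> n}"
    by (rule dvd_imp_le[OF prod_dvd_prod_subset]) (use pr in \<open>auto simp: L_def intro!: prod_pos prime_gt_0_nat\<close>)
  also have "\<dots> \<le> 4 ^ n" by (rule primorial_le)
  finally have 2: "(\<Prod>p\<in>L. p ^ multiplicity p B) \<le> 4 ^ n" .
  have cardS: "real (card S) \<le> sqrt (4 * real n)"
  proof -
    have "p \<le> nat \<lfloor>sqrt (4 * real n)\<rfloor>" if "p \<in> S" for p
    proof -
      have "real (p\<^sup>2) \<le> real (4 * n)" using that unfolding of_nat_le_iff by (simp add: S_def)
      then have "(real p)\<^sup>2 \<le> 4 * real n" by simp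
      then have "real p \<le> sqrt (4 * real n)" by (rule real_le_rsqrt)
      then show ?thesis by linarith
    qed
    moreover have "1 \<le> p" if "p \<in> S" for p
      using that pr(1)[of p] prime_ge_1_nat[of p] by (simp add: S_def)
    ultimately have "S \<subseteq> {1..nat \<lfloor>sqrt (4 * real n)\<rfloor>}" by auto
    then have "card S \<le> nat \<lfloor>sqrt (4 * real n)\<rfloor>"
      using card_mono[of "{1..nat \<lfloor>sqrt (4 * real n)\<rfloor>}" S] by simp
    also have "real (nat \<lfloor>sqrt (4 * real n)\<rfloor>) \<le> sqrt (4 * real n)" by simp
    finally show ?thesis by simp
  qed
  have "real B \<le> real ((4 * n) ^ card S * 4 ^ n)"
    unfolding of_nat_le_iff by (subst eq) (intro mult_mono 1 2; simp)
  also have "\<dots> = (4 * real n) powr real (card S) * 4 ^ n"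
    using assms(1) by (simp add: powr_realpow)
  also have "\<dots> \<le> (4 * real n) powr sqrt (4 * real n) * 4 ^ n"
    using cardS assms(1) by (intro mult_right_mono powr_mono) auto
  finally show ?thesis by (simp add: B_def)
qed

lemma prime_in_interval: "\<exists>C\<ge>1. \<forall>n\<ge>1. \<exists>p::nat. prime p \<and> n < p \<and> p \<le> C * n"
proof -
  have "eventually (\<lambda>n. (4 * real n) powr sqrt (4 * real n) * 4 ^ n < 4 ^ (2 * n) / (2 * real (2 * n))) at_top"
    by real_asymp
  then obtain n0 where n0: "\<And>n. n \<ge> n0 \<Longrightarrow> 
      (4 * real n) powr sqrt (4 * real n) * 4 ^ n < 4 ^ (2 * n) / (2 * real (2 * n))"
    by (auto simp: eventually_at_top_linorder)
  \<comment> \<open>One prime beyond the threshold serves all smaller \<open>n\<close>, at the price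
    of a larger constant.\<close>
  obtain q :: nat where q: "prime q" "q > n0" using bigger_prime by blast
  have "\<exists>p. prime p \<and> n < p \<and> p \<le> (4 + q) * n" if n: "n \<ge> 1" for n
  proof (cases "n \<ge> n0")
    case True
    show ?thesis
    proof (rule ccontr)
      assume *: "\<not> ?thesis"
      have "real ((4 * n) choose (2 * n)) \<le> (4 * real n) powr sqrt (4 * real n) * 4 ^ n"
      proof (rule central_binomial_le[OF n])
        fix p :: nat assume "prime p" "n < p"
        then have "(4 + q) * n < p" using * by (meson not_le)
        then show "4 * n < p" by (simp add: add_mult_distrib)
      qed
      moreover have "4 ^ (2 * n) / (2 * real (2 * n)) \<le> real ((2 * (2 * n)) choose (2 * n))"
        using n by (intro central_binomial_lower_bound) auto
      ultimately show False using n0[OF True] by simp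
    qed
  next
    case False
    have "q * 1 \<le> q * n" using n by (intro mult_le_mono2)
    then have "q \<le> (4 + q) * n" unfolding add_mult_distrib by linarith
    then show ?thesis using q False by (intro exI[of _ q]) auto
  qed
  then show ?thesis by (intro exI[of _ "4 + q"]) auto
qed

section \<open>Incidences of points and lines in an affine plane\<close>

lemma C4_free_incidence:
  assumes p: "prime (p::nat)"
  obtains R where "R \<subseteq> {..<p\<^sup>2} \<times> {..<p\<^sup>2}" "card R = p ^ 3"
    "\<And>P Q P' Q'. \<lbrakk>(P, Q) \<in> R; (P', Q) \<in> R; (P, Q') \<in> R; (P', Q') \<in> R\<rbrakk> \<Longrightarrow> P = P' \<or> Q = Q'"
proof -
  have p0: "0 < p" using p prime_gt_0_nat by blast
  define code where "code x y = p * x + y" for x y :: nat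
  have code_inj: "code x y = code x' y' \<longleftrightarrow> x = x' \<and> y = y'" if "y < p" "y' < p" for x y x' y'
  proof
    assume e: "code x y = code x' y'"
    have "code x y div p = x" "code x' y' div p = x'" using that by (simp_all add: code_def)
    then show "x = x' \<and> y = y'" using e by (auto simp: code_def)
  qed simp
  have code_less: "code x y < p\<^sup>2" if "x < p" "y < p" for x y
  proof -
    have "p * x + y < p * (x + 1)" using that by simp
    also have "\<dots> \<le> p * p" using that by (intro mult_le_mono2) auto
    finally show ?thesis by (simp add: code_def power2_eq_square)
  qed
  \<comment> \<open>The line with slope \<open>m\<close> and intercept \<open>b\<close> meets each
    abscissa \<open>x\<close> in one point, which gives the \<open>p ^ 3\<close> incidences;
    vertical lines are left out. Two common points of two lines give that \<open>p\<close> divides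
    \<open>(m - m') * (x - x')\<close>, so the lines or the points coincide.\<close>
  define f where "f = (\<lambda>(x, m, b). (code x ((m * x + b) mod p), code m b))"
  define R where "R = f ` ({..<p} \<times> {..<p} \<times> {..<p})"
  have inj: "inj_on f ({..<p} \<times> {..<p} \<times> {..<p})"
    using p0 by (auto simp: inj_on_def f_def code_inj)
  show thesis
  proof
    show "R \<subseteq> {..<p\<^sup>2} \<times> {..<p\<^sup>2}" using p0 by (auto simp: R_def f_def code_less)
    show "card R = p ^ 3" unfolding R_def card_image[OF inj] by (simp add: card_cartesian_product power3_eq_cube)
    fix P Q P' Q' assume "(P, Q) \<in> R" "(P', Q) \<in> R" "(P, Q') \<in> R" "(P', Q') \<in> R"
    then obtain x m b x' m' b' where *: "x < p" "m < p" "b < p" "x' < p" "m' < p" "b' < p"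
      "P = code x ((m * x + b) mod p)" "P' = code x' ((m * x' + b) mod p)" "Q = code m b" "Q' = code m' b'"
      and "(m * x + b) mod p = (m' * x + b') mod p" "(m * x' + b) mod p = (m' * x' + b') mod p"
      using p0 by (auto simp: R_def f_def code_inj)
    then have c: "[m * x + b = m' * x + b'] (mod p)" "[m * x' + b = m' * x' + b'] (mod p)"
      by (simp_all add: cong_def)
    then have "[int m * int x + int b = int m' * int x + int b'] (mod int p)" 
      "[int m * int x' + int b = int m' * int x' + int b'] (mod int p)"
      by (simp_all flip: of_nat_mult of_nat_add add: cong_int_iff)
    then have "int p dvd (int m * int x + int b) - (int m' * int x + int b')" 
      "int p dvd (int m * int x' + int b) - (int m' * int x' + int b')"
      by (simp_all add: cong_iff_dvd_diff)
    then have "int p dvd ((int m * int x + int b) - (int m' * int x + int b')) - 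
        ((int m * int x' + int b) - (int m' * int x' + int b'))"
      by (rule dvd_diff)
    also have "\<dots> = (int m - int m') * (int x - int x')" by (simp add: algebra_simps)
    finally have "int p dvd int m - int m' \<or> int p dvd int x - int x'"
      using p by (simp add: prime_dvd_mult_iff)
    then have "[m = m'] (mod p) \<or> [x = x'] (mod p)"
      by (simp add: cong_iff_dvd_diff flip: cong_int_iff)
    then show "P = P' \<or> Q = Q'"
    proof
      assume "[m = m'] (mod p)"
      then have "m = m'" using * by (simp add: cong_less_modulus_unique_nat)
      then have "b = b'" using c(1) * by (simp add: cong_add_lcancel_nat cong_less_modulus_unique_nat cong_add_lcancel)
      then show ?thesis using \<open>m = m'\<close> * by simp
    next
      assume "[x = x'] (mod p)"
      then have "x = x'" using * by (simp add: cong_less_modulus_unique_nat)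
      then show ?thesis using * by simp
    qed
  qed
qed

section \<open>The lower bound\<close>

lemma spanner_comm_cost_le:
  assumes "spanner_comm_cost \<alpha> s n = enat T"
  obtains \<pi> where "computes_spanner \<alpha> s n \<pi>"
    "\<And>P E h. P \<in> set_pmf \<pi> \<Longrightarrow> no_dup_input s n E \<Longrightarrow> run s P E h \<Longrightarrow> length h \<le> T"
proof -
  \<comment> \<open>A strict bound on the infimum yields a protocol, and for integers being below
    \<open>Suc T\<close> loses nothing.\<close>
  have "spanner_comm_cost \<alpha> s n < enat (Suc T)" using assms by simp
  then obtain \<pi> where \<pi>: "computes_spanner \<alpha> s n \<pi>" "protocol_cost s n \<pi> < enat (Suc T)"
    unfolding spanner_comm_cost_def INF_less_iff by auto
  have "length h \<le> T" if "P \<in> set_pmf \<pi>" "no_dup_input s n E" "run s P E h" for P E h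
  proof -
    have "enat (length h) \<le> protocol_cost s n \<pi>"
      unfolding protocol_cost_def using that by (intro Sup_upper) blast
    then have "enat (length h) < enat (Suc T)" using \<pi>(2) by (rule le_less_trans)
    then show ?thesis by simp
  qed
  then show thesis using that \<pi>(1) by blast
qed

lemma prime_order_bound:
  assumes p: "prime p" and n: "2 * p\<^sup>2 * s \<le> n" and s: "1 \<le> s"
    and cost: "spanner_comm_cost 3 s n = enat T"
  shows "real s * (real p ^ 3 * real s) \<le> 6912 * (3 * real T + real s)"
proof -
  obtain R where R: "R \<subseteq> {..<p\<^sup>2} \<times> {..<p\<^sup>2}" "card R = p ^ 3"
    "\<And>P Q P' Q'. \<lbrakk>(P, Q) \<in> R; (P', Q) \<in> R; (P, Q') \<in> R; (P', Q') \<in> R\<rbrakk> \<Longrightarrow> P = P' \<or> Q = Q'"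
    using C4_free_incidence[OF p] by blast
  interpret blowup s "p\<^sup>2" R
    by standard (use R s in auto)
  obtain \<pi> where "computes_spanner 3 s n \<pi>"
    "\<And>P E h. P \<in> set_pmf \<pi> \<Longrightarrow> no_dup_input s n E \<Longrightarrow> run s P E h \<Longrightarrow> length h \<le> T"
    using spanner_comm_cost_le[OF cost] by blast
  from randomized_bound[OF n this] show ?thesis by (simp add: R(2))
qed

theorem theorem4p5:
  "\<exists>c>0. \<exists>\<epsilon>>0. \<forall>s n :: nat. 1 \<le> s \<and> real s \<le> \<epsilon> * real n \<longrightarrow>
     ereal (c * sqrt (real s) * real n powr (3 / 2)) \<le> ereal_of_enat (spanner_comm_cost 3 s n)"
proof -
  obtain C :: nat where C: "C \<ge> 1" "\<And>m. m \<ge> 1 \<Longrightarrow> \<exists>p. prime p \<and> m < p \<and> p \<le> C * m"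
    using prime_in_interval by blast
  \<comment> \<open>The denominator is \<open>3 * 41472 * C ^ 3\<close>: 3 bounds
    \<open>2 * sqrt 2\<close>, which arises from \<open>x = n / (2 * s)\<close>, and
    \<open>C ^ 3\<close> is lost by choosing a prime \<open>p\<close> with
    \<open>z \<le> C * p\<close>.\<close>
  define c where "c = 1 / (124416 * real C ^ 3)"
  \<comment> \<open>Makes \<open>z / C\<close>, and hence \<open>p\<close>, at least 24.\<close>
  define \<epsilon> where "\<epsilon> = 1 / (2 * (24 * real C)\<^sup>2)"
  have "c * sqrt (real s) * real n powr (3 / 2) \<le> real T"
    if s: "1 \<le> s" and sn: "real s \<le> \<epsilon> * real n" and cost: "spanner_comm_cost 3 s n = enat T" for s n T
  proof -
    \<comment> \<open>The largest value of \<open>p\<^sup>2\<close> for which the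
      \<open>2 * p\<^sup>2 * s\<close> vertices fit into \<open>n\<close>; the prime is then chosen
      between \<open>z / C\<close> and \<open>z\<close>.\<close>
    define x where "x = real n / (2 * real s)"
    define z where "z = sqrt x"
    have x: "(24 * real C)\<^sup>2 \<le> x"
      using sn s C(1) by (simp add: x_def \<epsilon>_def field_simps)
    then have "24 * real C \<le> z" unfolding z_def by (rule real_le_rsqrt)
    then have zC: "24 \<le> z / real C" using C(1) by (simp add: field_simps)
    have x0: "0 \<le> x" by (simp add: x_def)
    define m where "m = nat \<lfloor>z / real C\<rfloor>"
    have m: "m \<ge> 1" "real m \<le> z / real C" "z / real C < real m + 1"
      using zC by (auto simp: m_def le_nat_iff le_floor_iff)
    obtain p where p: "prime p" "m < p" "p \<le> C * m" using C(2)[OF m(1)] by blast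
    have pz: "z / real C \<le> real p" using m(3) p(2) by linarith
    have "real p \<le> real C * real m" using p(3) by (metis of_nat_le_iff of_nat_mult)
    also have "\<dots> \<le> z" using m(2) C(1) by (simp add: field_simps)
    finally have "(real p)\<^sup>2 \<le> x"
      using x0 power_mono[of "real p" z 2] by (simp add: z_def)
    then have "real (2 * p\<^sup>2 * s) \<le> real n" using s by (simp add: x_def field_simps)
    then have "2 * p\<^sup>2 * s \<le> n" by (simp only: of_nat_le_iff)
    from prime_order_bound[OF p(1) this s cost]
    have main: "real s * (real p ^ 3 * real s) \<le> 6912 * (3 * real T + real s)" .
    \<comment> \<open>Since \<open>24 ^ 3 = 2 * 6912\<close>, the additive term
      \<open>6912 * s\<close> is at most half of the left side of \<open>main\<close> and is
      absorbed, which leaves \<open>41472 = 2 * 3 * 6912\<close>.\<close>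
    have "24 ^ 3 \<le> real p ^ 3" using zC pz by (intro power_mono) auto
    then have "real s * (24 ^ 3 * 1) \<le> real s * (real p ^ 3 * real s)"
      using s by (intro mult_left_mono mult_mono) auto
    then have T: "real s * (real p ^ 3 * real s) \<le> 41472 * real T" using main by simp
    have "sqrt (real s) * real n powr (3 / 2) \<le> 3 * (real s * (z ^ 3 * real s))"
    proof -
      define r where "r = sqrt (real s)"
      define w where "w = sqrt (real n)"
      have r: "real s = r\<^sup>2" "r > 0" using s by (auto simp: r_def)
      have w: "real n = w\<^sup>2" "w \<ge> 0" by (auto simp: w_def)
      have z: "z = w / (sqrt 2 * r)"
        by (simp add: z_def x_def real_sqrt_divide real_sqrt_mult r_def w_def)
      have "real n powr (3 / 2) = w ^ 3"
      proof (cases "n = 0")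
        case False
        then have "w > 0" by (simp add: w_def)
        have "real n powr (3 / 2) = (real n powr (1 / 2)) powr 3" by (simp add: powr_powr)
        also have "\<dots> = w powr 3" by (simp add: powr_half_sqrt w_def)
        also have "\<dots> = w ^ 3" using \<open>w > 0\<close> by (simp add: powr_numeral)
        finally show ?thesis .
      qed (simp add: w_def)
      moreover have "real s * (z ^ 3 * real s) = r * w ^ 3 / sqrt 2 ^ 3"
        unfolding z r(1) using r(2) by (simp add: field_simps power_mult_distrib eval_nat_numeral)
      moreover have "r * w ^ 3 \<le> 3 * (r * w ^ 3) / sqrt 2 ^ 3"
      proof -
        have "sqrt 2 ^ 3 = 2 * sqrt (2 :: real)" by (simp add: eval_nat_numeral)
        also have "\<dots> \<le> 2 * (3 / 2)" by (intro mult_left_mono real_le_lsqrt) (auto simp: power2_eq_square)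
        finally have "(r * w ^ 3) * sqrt 2 ^ 3 \<le> (r * w ^ 3) * 3"
          using r w by (intro mult_left_mono) auto
        then show ?thesis by (simp only: pos_le_divide_eq zero_less_power real_sqrt_gt_0_iff zero_less_numeral mult.commute[of 3])
      qed
      ultimately show ?thesis by (simp add: r_def[symmetric])
    qed
    also have "\<dots> \<le> 3 * (real s * ((real C * real p) ^ 3 * real s))"
      using pz C(1) x0 by (intro mult_left_mono mult_right_mono power_mono) (auto simp: field_simps z_def)
    also have "\<dots> = 3 * real C ^ 3 * (real s * (real p ^ 3 * real s))"
      by (simp add: power_mult_distrib)
    also have "\<dots> \<le> 3 * real C ^ 3 * (41472 * real T)"
      by (intro mult_left_mono T) auto
    finally show ?thesis using C(1) by (simp add: c_def field_simps)
  qed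
  then have "ereal (c * sqrt (real s) * real n powr (3 / 2)) \<le> ereal_of_enat (spanner_comm_cost 3 s n)"
    if "1 \<le> s" "real s \<le> \<epsilon> * real n" for s n
    using that by (cases "spanner_comm_cost 3 s n") auto
  moreover have "c > 0" "\<epsilon> > 0" using C(1) by (auto simp: c_def \<epsilon>_def)
  ultimately show ?thesis by blast
qed

end
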